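(* Let $G$ be a connected ribbon graph and $A\subseteq E(G)$. Then $A$ defines a biseparation of $G$ if and only if \[ \gamma(G^A)=\gamma(G|_A)+\gamma(G-A). \] Furthermore, if $A$ defines a biseparation of $G$, then $G^A$ is orientable if and only if both $G|_A$ and $G-A$ are orientable.
   Context: A ribbon graph $G=(V(G),E(G))$ is a (possibly non-orientable) surface with boundary represented as the union of two sets of closed discs, a set $V(G)$ of vertices and a set $E(G)$ of edges, such that: vertices and edges intersect in disjoint line segments; each such segment lies on the boundary of precisely one vertex and precisely one edge; every edge contains exactly two such segments. Ribbon graphs are considered up to homeomorphism (equivalently, they are cellularly embedded graphs). For $A\subseteq E(G)$, write $A^c=E(G)\setminus A$; $G|_A$ is the ribbon subgraph consisting of the edges in $A$ and their incident vertices; $G-A$ is obtained from $G$ by deleting the edges in $A$ (keeping all vertices). The Euler genus $\gamma$ of a connected ribbon graph (viewed as a punctured surface) is twice its genus if it is orientable and its (non-orientable) genus otherwise; for a disconnected ribbon graph $\gamma$ is the sum over components. Partial dual: for $A\subseteq E(G)$, arbitrarily orient the boundary of each edge of $G$. The boundary components of the spanning ribbon subgraph $(V(G),A)$ (naturally embedded in $G$) meet the edges of $G$ in disjoint arcs; on each such arc place an arrow pointing in the direction of the orientation of that edge's boundary and labelled by that edge. Taking each marked boundary component as the boundary of a new vertex disc, and, for each edge label $e$, attaching an edge disc by gluing two disjoint arcs of its (oriented) boundary to the two $e$-labelled arrows consistently with their directions, gives the partial dual $G^A$. Edges of $G^A$ are identified with those of $G$. $n$-sums: for a connected ribbon graph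 $G$ and non-trivial (not an isolated vertex) connected ribbon subgraphs $P,Q$ with $G=P\cup Q$ and $P\cap Q=\{v_1,\dots,v_n\}$ (vertices), $G$ is the $n$-sum $P\oplus_n Q$; write $\oplus$ for $\oplus_1$. $G$ is written as a sequence of $1$-sums $G=H_1\oplus H_2\oplus\cdots\oplus H_l$ meaning $(\cdots((H_1\oplus H_2)\oplus H_3)\cdots)\oplus H_l$ with each $H_i$ a ribbon subgraph of $G$ and each step a $1$-sum. Biseparation: $A\subseteq E(G)$ defines a biseparation of connected $G$ if either $A=E(G)$ or $A=\emptyset$, or $G$ can be written as a sequence of $1$-sums whose summands are the components of $G|_A$ and of $G|_{A^c}$ and in which each $1$-sum involves a component of $G|_A$ and a component of $G|_{A^c}$. *)

theory Defs
  imports Complex_Main "HOL-Library.While_Combinator"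
begin

text \<open>
  A ribbon graph, up to homeomorphism, is encoded by the way its discs are glued.  The boundary
  circle of an edge disc is divided by four corners, the \<^emph>\<open>flags\<close>, into two segments shared with
  vertex discs and two free sides.  The boundary circle of a vertex disc is divided by the flags
  on it into the segments shared with edge discs and free arcs.  Every flag \<open>x\<close> is an end point of
  one segment, one free side and one free arc; the opposite end points of these are \<open>seg x\<close>,
  \<open>side x\<close> and \<open>arc x\<close>.  Isolated vertices carry no flags.
\<close>

record ('v, 'e, 'f) rgraph =
  verts :: "'v set"
  edges :: "'e set"
  flags :: "'f set"
  vert_of :: "'f \<Rightarrow> 'v"
  edge_of :: "'f \<Rightarrow> 'e"
  seg :: "'f \<Rightarrow> 'f"
  side :: "'f \<Rightarrow> 'f"
  arc :: "'f \<Rightarrow> 'f"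

definition orbit_of :: "('f \<Rightarrow> 'f) set \<Rightarrow> 'f \<Rightarrow> 'f set" where
  "orbit_of S x = {y. (x, y) \<in> {(z, w). \<exists>f\<in>S. w = f z}\<^sup>*}"

text \<open>
  The axioms \<open>edge_disc\<close> and \<open>edge_card\<close> say that the boundary of an edge disc is one circle
  through four flags along which segments and free sides alternate; \<open>vertex_disc\<close> says that the
  boundary of a vertex disc with at least one segment is one circle.
\<close>

locale ribbon_graph =
  fixes G :: "('v, 'e, 'f) rgraph"
  assumes finite_verts: "finite (verts G)"
    and finite_flags: "finite (flags G)"
    and vert_of_in: "x \<in> flags G \<Longrightarrow> vert_of G x \<in> verts G"
    and edge_of_image: "edge_of G ` flags G = edges G"
    and seg_in: "x \<in> flags G \<Longrightarrow> seg G x \<in> flags G"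
    and side_in: "x \<in> flags G \<Longrightarrow> side G x \<in> flags G"
    and arc_in: "x \<in> flags G \<Longrightarrow> arc G x \<in> flags G"
    and seg_seg: "x \<in> flags G \<Longrightarrow> seg G (seg G x) = x"
    and side_side: "x \<in> flags G \<Longrightarrow> side G (side G x) = x"
    and arc_arc: "x \<in> flags G \<Longrightarrow> arc G (arc G x) = x"
    and arc_neq: "x \<in> flags G \<Longrightarrow> arc G x \<noteq> x"
    and edge_disc: "x \<in> flags G \<Longrightarrow>
      {y \<in> flags G. edge_of G y = edge_of G x} = {x, seg G x, side G x, seg G (side G x)}"
    and edge_card: "x \<in> flags G \<Longrightarrow> card {y \<in> flags G. edge_of G y = edge_of G x} = 4"
    and vertex_disc: "x \<in> flags G \<Longrightarrow>
      {y \<in> flags G. vert_of G y = vert_of G x} = orbit_of {seg G, arc G} x"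

definition isolated_verts :: "('v, 'e, 'f) rgraph \<Rightarrow> 'v set" where
  "isolated_verts G = verts G - vert_of G ` flags G"

text \<open>
  The boundary components of the spanning ribbon subgraph \<open>(V(G), A)\<close>, drawn in \<open>G\<close>: such a curve
  follows the free arcs of the vertices of \<open>G\<close>, the free sides of the edges in \<open>A\<close>, and the
  segments at which the edges outside \<open>A\<close> are attached.  So \<open>across G A\<close> joins the two end points
  of an arc in which the boundary of \<open>(V(G), A)\<close> meets an edge of \<open>G\<close>.  A boundary component is
  represented by the flags on it, or by the isolated vertex of \<open>G\<close> that it bounds.
\<close>

definition across :: "('v, 'e, 'f) rgraph \<Rightarrow> 'e set \<Rightarrow> 'f \<Rightarrow> 'f" where
  "across G A x = (if edge_of G x \<in> A then side G x else seg G x)"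

definition boundary_comps :: "('v, 'e, 'f) rgraph \<Rightarrow> 'e set \<Rightarrow> ('f set + 'v) set" where
  "boundary_comps G A =
     Inl ` orbit_of {across G A, arc G} ` flags G \<union> Inr ` isolated_verts G"

text \<open>
  The marked arcs of the boundary components of \<open>(V(G), A)\<close> become the segments of the partial
  dual.  The free sides of the new edge disc \<open>e\<close> run from the head of one \<open>e\<close>-labelled arrow to the
  tail of the other.  Both arrows follow the boundary circle of the old disc \<open>e\<close>, so these sides
  join the same pairs of flags as the part of that circle not covered by the arrows: the segments
  of \<open>e\<close> if \<open>e \<in> A\<close>, and its free sides otherwise; see \<open>partial_dual_arrows\<close> below.
\<close>

definition partial_dual :: "('v, 'e, 'f) rgraph \<Rightarrow> 'e set \<Rightarrow> ('f set + 'v, 'e, 'f) rgraph" where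
  "partial_dual G A =
     \<lparr> verts = boundary_comps G A,
       edges = edges G,
       flags = flags G,
       vert_of = (\<lambda>x. Inl (orbit_of {across G A, arc G} x)),
       edge_of = edge_of G,
       seg = across G A,
       side = (\<lambda>x. if edge_of G x \<in> A then seg G x else side G x),
       arc = arc G \<rparr>"

text \<open>
  Let \<open>t\<close> orient the boundary of every edge disc: it is left along the segment at the flags with
  \<open>t x\<close> and along the free side at the others.  The arrow on the arc from \<open>x\<close> to \<open>across G A x\<close>
  then points along this orientation, and \<open>tail\<close> tells whether it starts at \<open>x\<close>.
\<close>

lemma (in ribbon_graph) partial_dual_arrows:
  fixes t :: "'f \<Rightarrow> bool" and A :: "'e set"
  assumes t: "\<And>y. y \<in> flags G \<Longrightarrow> t (seg G y) \<noteq> t y \<and> t (side G y) \<noteq> t y"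
    and x: "x \<in> flags G"
  defines "tail \<equiv> \<lambda>y. if edge_of G y \<in> A then \<not> t y else t y"
  shows "side (partial_dual G A) x =
    (THE y. y \<in> flags G \<and> edge_of G y = edge_of G x \<and> y \<notin> {x, across G A x} \<and> tail y \<noteq> tail x)"
proof -
  let ?s = "side (partial_dual G A) x"
  have set: "{y \<in> flags G. edge_of G y = edge_of G x} = {x, seg G x, side G x, seg G (side G x)}"
    using edge_disc[OF x] .
  have c: "card {x, seg G x, side G x, seg G (side G x)} = 4"
    using edge_card[OF x] set by simp
  have d: "x \<noteq> seg G x" "x \<noteq> side G x" "seg G x \<noteq> side G x"
    using c by (auto simp: card_insert_if split: if_splits)
  have tx: "t (seg G x) \<noteq> t x" "t (side G x) \<noteq> t x" "t (seg G (side G x)) = t x"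
    using t[OF x] t[OF side_in[OF x]] by auto
  have s: "?s = (if edge_of G x \<in> A then seg G x else side G x)"
    by (simp add: partial_dual_def)
  have mem: "y \<in> flags G \<and> edge_of G y = edge_of G x \<longleftrightarrow>
      y \<in> {x, seg G x, side G x, seg G (side G x)}" for y
    using set by blast
  have "y \<in> flags G \<and> edge_of G y = edge_of G x \<and> y \<notin> {x, across G A x} \<and> tail y \<noteq> tail x
      \<longleftrightarrow> y = ?s" for y
  proof (cases "y \<in> flags G \<and> edge_of G y = edge_of G x")
    case True
    then have "tail y \<noteq> tail x \<longleftrightarrow> t y \<noteq> t x" by (auto simp: tail_def)
    moreover have "y \<in> {x, seg G x, side G x, seg G (side G x)}" using True mem by blast
    ultimately show ?thesis using True d tx unfolding s across_def by auto
  next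
    case False
    moreover have "?s \<in> {x, seg G x, side G x, seg G (side G x)}" using s by auto
    ultimately show ?thesis using mem by metis
  qed
  then show ?thesis by (simp add: the_equality)
qed

text \<open>
  The ribbon subgraph with vertices \<open>W\<close> and edges \<open>B\<close>, for \<open>W\<close> containing the ends of all edges
  in \<open>B\<close>.  A free arc of a vertex now passes over all segments of removed edges.  The values
  outside the set of flags are irrelevant; they are fixed so that ribbon subgraphs with the same
  vertices and edges are equal.
\<close>

definition sub_rgraph ::
  "('v, 'e, 'f) rgraph \<Rightarrow> 'v set \<Rightarrow> 'e set \<Rightarrow> ('v, 'e, 'f) rgraph" where
  "sub_rgraph G W B =
    (let F = {x \<in> flags G. edge_of G x \<in> B} in
     \<lparr> verts = W,
       edges = B,
       flags = F,
       vert_of = (\<lambda>x. if x \<in> F then vert_of G x else undefined),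
       edge_of = (\<lambda>x. if x \<in> F then edge_of G x else undefined),
       seg = (\<lambda>x. if x \<in> F then seg G x else x),
       side = (\<lambda>x. if x \<in> F then side G x else x),
       arc = (\<lambda>x. if x \<in> F
                 then while (\<lambda>y. edge_of G y \<notin> B) (\<lambda>y. arc G (seg G y)) (arc G x)
                 else x) \<rparr>)"

definition ends :: "('v, 'e, 'f) rgraph \<Rightarrow> 'e set \<Rightarrow> 'v set" where
  "ends G B = vert_of G ` {x \<in> flags G. edge_of G x \<in> B}"

definition ribbon_subgraph :: "('v, 'e, 'f) rgraph \<Rightarrow> ('v, 'e, 'f) rgraph \<Rightarrow> bool" where
  "ribbon_subgraph H G \<longleftrightarrow>
     verts H \<subseteq> verts G \<and> edges H \<subseteq> edges G \<and> ends G (edges H) \<subseteq> verts H \<and>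
     H = sub_rgraph G (verts H) (edges H)"

definition restrict_edges :: "('v, 'e, 'f) rgraph \<Rightarrow> 'e set \<Rightarrow> ('v, 'e, 'f) rgraph" where
  "restrict_edges G A = sub_rgraph G (ends G A) A"

definition delete_edges :: "('v, 'e, 'f) rgraph \<Rightarrow> 'e set \<Rightarrow> ('v, 'e, 'f) rgraph" where
  "delete_edges G A = sub_rgraph G (verts G) (edges G - A)"

definition adj :: "('v, 'e, 'f) rgraph \<Rightarrow> ('v \<times> 'v) set" where
  "adj G = {(vert_of G x, vert_of G (side G x)) | x. x \<in> flags G}"

definition connected_rgraph :: "('v, 'e, 'f) rgraph \<Rightarrow> bool" where
  "connected_rgraph G \<longleftrightarrow>
     verts G \<noteq> {} \<and> (\<forall>u\<in>verts G. \<forall>v\<in>verts G. (u, v) \<in> (adj G)\<^sup>*)"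

definition component_of :: "('v, 'e, 'f) rgraph \<Rightarrow> 'v \<Rightarrow> ('v, 'e, 'f) rgraph" where
  "component_of G u =
     (let C = {v \<in> verts G. (u, v) \<in> (adj G)\<^sup>*}
      in sub_rgraph G C (edge_of G ` {x \<in> flags G. vert_of G x \<in> C}))"

definition components :: "('v, 'e, 'f) rgraph \<Rightarrow> ('v, 'e, 'f) rgraph set" where
  "components G = component_of G ` verts G"

text \<open>
  An orientation of a disc is given by the flags at which its segments start when its boundary is
  traversed.  The surface is orientable if the discs can be oriented so that the two orientations
  induced on each common segment are opposite; then the flags where the segments of the edge discs
  start (\<open>s x\<close>) alternate along all segments, free sides and free arcs.
\<close>

definition orientable :: "('v, 'e, 'f) rgraph \<Rightarrow> bool" where
  "orientable G \<longleftrightarrow>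
     (\<exists>s :: 'f \<Rightarrow> bool. \<forall>x\<in>flags G.
        s (seg G x) \<noteq> s x \<and> s (side G x) \<noteq> s x \<and> s (arc G x) \<noteq> s x)"

text \<open>
  The Euler characteristic of the closed surface obtained by capping all boundary components with
  discs.  For a connected surface of genus \<open>g\<close> it is \<open>2 - 2 g\<close> in the orientable and \<open>2 - g\<close> in the
  non-orientable case, which determines the genus.
\<close>

definition euler_char :: "('v, 'e, 'f) rgraph \<Rightarrow> rat" where
  "euler_char G = of_nat (card (verts G)) - of_nat (card (edges G))
     + of_nat (card (boundary_comps G (edges G)))"

definition genus :: "('v, 'e, 'f) rgraph \<Rightarrow> rat" where
  "genus H = (if orientable H then (2 - euler_char H) / 2 else 2 - euler_char H)"

definition euler_genus :: "('v, 'e, 'f) rgraph \<Rightarrow> rat" where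
  "euler_genus G = (\<Sum>H\<in>components G. if orientable H then 2 * genus H else genus H)"

definition n_sum ::
  "nat \<Rightarrow> ('v, 'e, 'f) rgraph \<Rightarrow> ('v, 'e, 'f) rgraph \<Rightarrow> ('v, 'e, 'f) rgraph \<Rightarrow> bool" where
  "n_sum n G P Q \<longleftrightarrow>
     connected_rgraph G \<and>
     ribbon_subgraph P G \<and> connected_rgraph P \<and> edges P \<noteq> {} \<and>
     ribbon_subgraph Q G \<and> connected_rgraph Q \<and> edges Q \<noteq> {} \<and>
     verts P \<union> verts Q = verts G \<and> edges P \<union> edges Q = edges G \<and>
     edges P \<inter> edges Q = {} \<and> finite (verts P \<inter> verts Q) \<and> card (verts P \<inter> verts Q) = n"

text \<open>\<open>one_sum_seq Hs G\<close>: \<open>G\<close> is \<open>(\<dots>((H\<^sub>1 \<oplus> H\<^sub>2) \<oplus> H\<^sub>3)\<dots>) \<oplus> H\<^sub>l\<close> for \<open>Hs = [H\<^sub>1, \<dots>, H\<^sub>l]\<close>.\<close>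

inductive one_sum_seq :: "('v, 'e, 'f) rgraph list \<Rightarrow> ('v, 'e, 'f) rgraph \<Rightarrow> bool" where
  single: "one_sum_seq [H] H"
| step: "one_sum_seq Hs K \<Longrightarrow> n_sum 1 G K H \<Longrightarrow> one_sum_seq (Hs @ [H]) G"

text \<open>
  A \<open>1\<close>-sum in the sequence glues \<open>H\<^sub>i\<close> at one vertex to an earlier summand \<open>H\<^sub>j\<close> containing that
  vertex; these are the two components that it involves.
\<close>

definition biseparation :: "('v, 'e, 'f) rgraph \<Rightarrow> 'e set \<Rightarrow> bool" where
  "biseparation G A \<longleftrightarrow>
     A = edges G \<or> A = {} \<or>
     (let P = components (restrict_edges G A);
          Q = components (restrict_edges G (edges G - A))
      in \<exists>Hs. one_sum_seq Hs G \<and> distinct Hs \<and> set Hs = P \<union> Q \<and>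
           (\<forall>i. 0 < i \<and> i < length Hs \<longrightarrow>
              (\<exists>j<i. verts (Hs ! i) \<inter> verts (Hs ! j) \<noteq> {} \<and>
                 (Hs ! i \<in> P \<and> Hs ! j \<in> Q \<or> Hs ! i \<in> Q \<and> Hs ! j \<in> P))))"

end

theory Submission
  imports Defs
begin

text \<open>
  For \<open>B \<subseteq> E(G)\<close> write \<open>k(B)\<close> and \<open>f(B)\<close> for the numbers of components and of boundary components
  of \<open>(V(G), B)\<close>.  The vertices of \<open>G\<^sup>A\<close> are counted by \<open>f(A)\<close> and its boundary components by
  \<open>f(A\<^sup>c)\<close>, so in the Euler genera of \<open>G\<^sup>A\<close>, \<open>G|\<^sub>A\<close> and \<open>G - A\<close> the boundary terms cancel, and the
  genus identity says \<open>k(A) + k(A\<^sup>c) = |V(G)| + 1\<close>: the connected bipartite graph of components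
  of \<open>(V(G), A)\<close> and \<open>(V(G), A\<^sup>c)\<close>, with one edge for each vertex of \<open>G\<close>, is a tree.  A sequence of
  \<open>1\<close>-sums gives this count, since each \<open>1\<close>-sum identifies one vertex.  Conversely the components,
  listed so that each meets an earlier one, meet the union of the earlier ones in exactly one
  vertex, for otherwise the count would be smaller.

  The surfaces \<open>G\<close> and \<open>G\<^sup>A\<close> have the same orientability condition on flags, and \<open>1\<close>-sums of
  orientable ribbon graphs are orientable, by reversing one summand if necessary.
\<close>

subsection \<open>Orbits of involutions\<close>

text \<open>The doubling in \<open>euler_genus\<close> makes it 2k - v + e - f regardless of
  orientability. As G^A is connected, gamma(G^A) = 2 - f(A) + e - f(A^c), while the other side is
  2(k(A) + k(A^c)) - 2v + e - f(A) - f(A^c); they differ by 2(k(A) + k(A^c) - v - 1). Three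
  obstacles shape the work. \<open>restrict_edges\<close> drops the vertices that meet no chosen
  edge whereas \<open>delete_edges\<close> keeps them, so both are compared with the spanning
  subgraph. The free arcs of a ribbon subgraph come from a \<open>while\<close> loop, so termination
  and the orbits of the resulting involution have to be settled before any curve can be counted.
  Ribbon subgraphs are compared as records, not up to isomorphism, so nested restrictions must be
  literally equal. An orientation of all vertex discs is a 2-colouring of the flags that alternates
  around each circle. It is extracted from the dihedral action of two fixed-point-free involutions;
  parity along it excludes fixed points of the new arcs, and signs relative to it control the gluing
  of orientations.\<close>

definition involutive_on :: "'f set \<Rightarrow> ('f \<Rightarrow> 'f) set \<Rightarrow> bool" where
  "involutive_on F S \<longleftrightarrow> (\<forall>f\<in>S. \<forall>x\<in>F. f x \<in> F \<and> f (f x) = x)"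

lemma orbit_of_refl [simp]: "x \<in> orbit_of S x"
  by (simp add: orbit_of_def)

lemma orbit_of_step: "y \<in> orbit_of S x \<Longrightarrow> f \<in> S \<Longrightarrow> f y \<in> orbit_of S x"
  unfolding orbit_of_def by (auto intro: rtrancl_into_rtrancl)

lemma orbit_of_induct [consumes 1, case_names refl step]:
  assumes "y \<in> orbit_of S x" and "P x"
    and "\<And>z f. z \<in> orbit_of S x \<Longrightarrow> f \<in> S \<Longrightarrow> P z \<Longrightarrow> P (f z)"
  shows "P y"
proof -
  have "(x, y) \<in> {(z, w). \<exists>f\<in>S. w = f z}\<^sup>*"
    using assms(1) by (simp add: orbit_of_def)
  then show ?thesis
    by (induction rule: rtrancl_induct) (use assms(2,3) in \<open>auto simp: orbit_of_def\<close>)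
qed

lemma orbit_of_trans:
  assumes "y \<in> orbit_of S x" "z \<in> orbit_of S y"
  shows "z \<in> orbit_of S x"
  using assms by (simp add: orbit_of_def)

lemma orbit_of_subset:
  assumes "x \<in> F" "\<And>f z. f \<in> S \<Longrightarrow> z \<in> F \<Longrightarrow> f z \<in> F"
  shows "orbit_of S x \<subseteq> F"
proof
  fix y assume "y \<in> orbit_of S x"
  then show "y \<in> F" by (induction rule: orbit_of_induct) (use assms in auto)
qed

lemma involutive_orbit_subset:
  "involutive_on F S \<Longrightarrow> x \<in> F \<Longrightarrow> orbit_of S x \<subseteq> F"
  by (rule orbit_of_subset) (auto simp: involutive_on_def)

text \<open>\<open>orbit_of\<close> is only forward reachability, but an involution undoes each of
  its own steps. The set \<open>F\<close> is carried along because the structure maps are arbitrary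
  outside the flags.\<close>

lemma orbit_of_sym:
  assumes "involutive_on F S" "x \<in> F" "y \<in> orbit_of S x"
  shows "x \<in> orbit_of S y"
  using assms(3)
proof (induction rule: orbit_of_induct)
  case (step z f)
  have "z \<in> F" using step(1) involutive_orbit_subset[OF assms(1,2)] by blast
  then have "f (f z) = z" using assms(1) step(2) unfolding involutive_on_def by blast
  then have "z \<in> orbit_of S (f z)"
    using orbit_of_step[OF orbit_of_refl step(2), of "f z"] by simp
  then show ?case using step(3) orbit_of_trans by metis
qed simp

lemma orbit_of_eq:
  assumes "involutive_on F S" "x \<in> F" "y \<in> orbit_of S x"
  shows "orbit_of S y = orbit_of S x"
  using orbit_of_trans orbit_of_sym assms by (metis subsetI subset_antisym)

text \<open>A chain of steps from \<open>x\<close> never leaves \<open>F\<close>, so values outside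
  \<open>F\<close> cannot matter. This moves orbits between structures whose maps agree only on some
  flags.\<close>

lemma orbit_of_cong:
  assumes "x \<in> F" "\<And>z. z \<in> F \<Longrightarrow> f z = f' z \<and> g z = g' z \<and> f z \<in> F \<and> g z \<in> F"
  shows "orbit_of {f, g} x = orbit_of {f', g'} x"
proof -
  have 1: "orbit_of {f, g} x \<subseteq> F" by (rule orbit_of_subset) (use assms in auto)
  have "f' z \<in> F" "g' z \<in> F" if "z \<in> F" for z
    using assms(2)[OF that] by metis+
  then have 2: "orbit_of {f', g'} x \<subseteq> F"
    using assms(1) by (intro orbit_of_subset) auto
  show ?thesis
  proof (intro equalityI subsetI)
    fix y assume "y \<in> orbit_of {f, g} x"
    then show "y \<in> orbit_of {f', g'} x"
    proof (induction rule: orbit_of_induct)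
      case (step z h)
      then have "h z = f' z \<or> h z = g' z" using 1 assms by auto
      then show ?case using orbit_of_step[OF step(3), of f'] orbit_of_step[OF step(3), of g'] by auto
    qed simp
  next
    fix y assume "y \<in> orbit_of {f', g'} x"
    then show "y \<in> orbit_of {f, g} x"
    proof (induction rule: orbit_of_induct)
      case (step z h)
      then have "h z = f z \<or> h z = g z" using 2 assms by auto
      then show ?case using orbit_of_step[OF step(3), of f] orbit_of_step[OF step(3), of g] by auto
    qed simp
  qed
qed

section \<open>A 2-colouring for two fixed-point-free involutions\<close>

context
  fixes F :: "'f set" and p a :: "'f \<Rightarrow> 'f"
  assumes inv: "involutive_on F {p, a}"
    and p_neq: "\<And>x. x \<in> F \<Longrightarrow> p x \<noteq> x"
    and a_neq: "\<And>x. x \<in> F \<Longrightarrow> a x \<noteq> x"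
begin

lemma involutions_simps:
  "x \<in> F \<Longrightarrow> p x \<in> F" "x \<in> F \<Longrightarrow> a x \<in> F" "x \<in> F \<Longrightarrow> p (p x) = x" "x \<in> F \<Longrightarrow> a (a x) = x"
  using inv by (auto simp: involutive_on_def)

lemma rotation_power_in: "x \<in> F \<Longrightarrow> ((a \<circ> p) ^^ n) x \<in> F"
  by (induction n) (auto simp: involutions_simps)

text \<open>The reflection \<open>p\<close> conjugates the rotation \<open>a \<circ> p\<close> to its inverse.  So a rotation agreeing with
  \<open>p\<close> at a point yields, half way, a fixed point of \<open>p\<close> or of \<open>a\<close>.\<close>

lemma rotation_power_neq: "x \<in> F \<Longrightarrow> ((a \<circ> p) ^^ n) x \<noteq> p x"
proof (induction n arbitrary: x rule: less_induct)
  case (less n)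
  consider "n = 0" | "n = 1" | m where "n = Suc (Suc m)"
    by (metis One_nat_def not0_implies_Suc)
  then show ?case
  proof cases
    case 1 then show ?thesis using p_neq less(2) by force
  next
    case 2 then show ?thesis using a_neq[of "p x"] less(2) involutions_simps by auto
  next
    case (3 m)
    let ?y = "a (p x)"
    have y: "?y \<in> F" using less(2) involutions_simps by auto
    have ym: "((a \<circ> p) ^^ m) ?y \<in> F" using rotation_power_in[OF y] .
    have eq: "((a \<circ> p) ^^ n) x = a (p (((a \<circ> p) ^^ m) ?y))"
      unfolding 3 funpow_Suc_right by (simp add: funpow_swap1[of "a \<circ> p", simplified])
    show ?thesis
    proof
      assume "((a \<circ> p) ^^ n) x = p x"
      then have "p (a (a (p (((a \<circ> p) ^^ m) ?y)))) = p ?y" using eq by simp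
      then have "((a \<circ> p) ^^ m) ?y = p ?y" using ym by (simp add: involutions_simps)
      then show False using less(1)[OF _ y] 3 by auto
    qed
  qed
qed

text \<open>Since \<open>p \<circ> a\<close> inverts \<open>a \<circ> p\<close> on \<open>F\<close>,
  a chain of both cancels to a power of one of them. Writing an inverse power as
  \<open>x = ((a \<circ> p) ^^ n) y\<close> avoids iterating a second map.\<close>

lemma rotation_orbit_powers:
  assumes "x \<in> F" "y \<in> orbit_of {a \<circ> p, p \<circ> a} x"
  shows "y \<in> F \<and> (\<exists>n. y = ((a \<circ> p) ^^ n) x \<or> x = ((a \<circ> p) ^^ n) y)"
  using assms(2)
proof (induction rule: orbit_of_induct)
  case refl
  then show ?case using assms by (auto intro: exI[of _ 0])
next
  case (step z f)
  then obtain n where z: "z \<in> F" and n: "z = ((a \<circ> p) ^^ n) x \<or> x = ((a \<circ> p) ^^ n) z" by blast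
  have inv': "a (p (p (a z))) = z" "p (a (a (p z))) = z" using z by (simp_all add: involutions_simps)
  have fF: "f z \<in> F" using step(2) z involutions_simps by auto
  show ?case
  proof (cases n)
    case 0
    then have "z = x" using n by auto
    then have "f z = ((a \<circ> p) ^^ 1) x \<or> x = ((a \<circ> p) ^^ 1) (f z)"
      using step(2) inv' by auto
    then show ?thesis using fF by blast
  next
    case (Suc m)
    from n show ?thesis
    proof
      assume zz: "z = ((a \<circ> p) ^^ n) x"
      have "((a \<circ> p) ^^ m) x \<in> F" using rotation_power_in assms(1) .
      then have "p (a z) = ((a \<circ> p) ^^ m) x" using zz Suc by (simp add: involutions_simps)
      moreover have "a (p z) = ((a \<circ> p) ^^ Suc n) x" using zz by simp
      ultimately have "f z = ((a \<circ> p) ^^ m) x \<or> f z = ((a \<circ> p) ^^ Suc n) x"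
        using step(2) by auto
      then show ?thesis using fF by blast
    next
      assume xx: "x = ((a \<circ> p) ^^ n) z"
      have "x = ((a \<circ> p) ^^ m) (a (p z))" using xx Suc by (simp add: funpow_swap1)
      moreover have "x = ((a \<circ> p) ^^ Suc n) (p (a z))"
        using xx inv' by (simp add: funpow_swap1)
      ultimately have "x = ((a \<circ> p) ^^ m) (f z) \<or> x = ((a \<circ> p) ^^ Suc n) (f z)"
        using step(2) by auto
      then show ?thesis using fF by blast
    qed
  qed
qed

text \<open>Of the two possible relations between \<open>x\<close> and \<open>p x\<close>, one is
  excluded by \<open>rotation_power_neq\<close> at \<open>x\<close>, the other by the same fact at
  \<open>p x\<close>, as \<open>x = p (p x)\<close>.\<close>

lemma reflection_notin_rotation_orbit:
  assumes "x \<in> F" shows "p x \<notin> orbit_of {a \<circ> p, p \<circ> a} x"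
  using rotation_orbit_powers[OF assms, of "p x"] rotation_power_neq[OF assms]
    rotation_power_neq[of "p x"] assms involutions_simps by metis

lemma rotation_orbit_sym:
  assumes "x \<in> F" "y \<in> orbit_of {a \<circ> p, p \<circ> a} x"
  shows "x \<in> orbit_of {a \<circ> p, p \<circ> a} y"
  using assms(2)
proof (induction rule: orbit_of_induct)
  case (step z f)
  have z: "z \<in> F" using rotation_orbit_powers assms(1) step(1) by blast
  have "z = (p \<circ> a) (f z) \<or> z = (a \<circ> p) (f z)"
    using step(2) z by (auto simp: involutions_simps)
  then have "z \<in> orbit_of {a \<circ> p, p \<circ> a} (f z)"
    by (metis insert_iff orbit_of_refl orbit_of_step)
  then show ?case using step(3) orbit_of_trans by metis
qed simp

text \<open>Rotations have index 2 in the group generated by \<open>p\<close> and \<open>a\<close>: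
  each orbit splits into a rotation orbit and its mirror image under \<open>p\<close>, and these are
  the colour classes.\<close>

lemma two_coloring:
  "\<exists>c :: 'f \<Rightarrow> bool. \<forall>x\<in>F. c (p x) \<noteq> c x \<and> c (a x) \<noteq> c x"
proof -
  \<comment> \<open>\<open>r\<close> depends only on the orbit, so all points of one orbit are
    compared with the same rotation class.\<close>
  define r where "r x = (SOME y. y \<in> orbit_of {p, a} x)" for x
  define T where "T x = orbit_of {a \<circ> p, p \<circ> a} x" for x
  define c where "c x = (x \<in> T (r x))" for x
  have r_in: "r x \<in> orbit_of {p, a} x" for x
    unfolding r_def by (rule someI[of _ x]) simp
  have rF: "r x \<in> F" if "x \<in> F" for x
    using r_in involutive_orbit_subset[OF inv that] by blast
  have TF: "T x \<subseteq> F" if "x \<in> F" for x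
    using rotation_orbit_powers[OF that] by (auto simp: T_def)
  \<comment> \<open>Either involution exchanges the two halves:
    \<open>a z = p ((p \<circ> a) z)\<close>, and \<open>a (p t)\<close> is a rotation of
    \<open>t\<close>.\<close>
  have cover: "y \<in> T x \<union> p ` T x" if x: "x \<in> F" and y: "y \<in> orbit_of {p, a} x" for x y
    using y
  proof (induction rule: orbit_of_induct)
    case refl show ?case by (simp add: T_def)
  next
    case (step z f)
    from step(3) show ?case
    proof
      assume z: "z \<in> T x"
      have "a z = p (p (a z))" using z TF[OF x] involutions_simps by auto
      moreover have "p (a z) \<in> T x"
        using orbit_of_step[of z "{a \<circ> p, p \<circ> a}" x "p \<circ> a"] z by (simp add: T_def)
      ultimately show ?case using step(2) z by auto
    next
      assume "z \<in> p ` T x"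
      then obtain t where t: "t \<in> T x" "z = p t" by blast
      then have "p z = t" using TF[OF x] involutions_simps by auto
      moreover have "a z \<in> T x"
        using orbit_of_step[of t "{a \<circ> p, p \<circ> a}" x "a \<circ> p"] t by (simp add: T_def)
      ultimately show ?case using step(2) t by auto
    qed
  qed
  have flip: "c (p x) \<noteq> c x" if x: "x \<in> F" for x
  proof -
    have "orbit_of {p, a} (p x) = orbit_of {p, a} x"
      by (rule orbit_of_eq[OF inv x]) (simp add: orbit_of_step)
    then have rr: "r (p x) = r x" by (simp add: r_def)
    have "x \<in> orbit_of {p, a} (r x)" using orbit_of_sym[OF inv x r_in] .
    then have xc: "x \<in> T (r x) \<or> x \<in> p ` T (r x)" using cover rF x by blast
    have "p x \<notin> T (r x)" if "x \<in> T (r x)"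
    proof
      assume "p x \<in> T (r x)"
      moreover have "r x \<in> T x" using that rotation_orbit_sym rF[OF x] by (simp add: T_def)
      ultimately have "p x \<in> T x" using orbit_of_trans unfolding T_def by metis
      then show False using reflection_notin_rotation_orbit[OF x] by (simp add: T_def)
    qed
    moreover have "p x \<in> T (r x)" if "x \<in> p ` T (r x)"
      using that TF[OF rF[OF x]] involutions_simps by auto
    ultimately show ?thesis using xc by (auto simp: c_def rr)
  qed
  have rot: "c (a (p x)) = c x" if x: "x \<in> F" for x
  proof -
    have "a (p x) \<in> orbit_of {p, a} x" by (simp add: orbit_of_step)
    then have "orbit_of {p, a} (a (p x)) = orbit_of {p, a} x"
      by (rule orbit_of_eq[OF inv x])
    then have rr: "r (a (p x)) = r x" by (simp add: r_def)
    have "a (p x) \<in> T (r x)" if "x \<in> T (r x)"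
      using orbit_of_step[of x _ "r x" "a \<circ> p"] that by (simp add: T_def)
    moreover have "x \<in> T (r x)" if "a (p x) \<in> T (r x)"
      using orbit_of_step[of "a (p x)" _ "r x" "p \<circ> a"] that x
      by (simp add: T_def involutions_simps)
    ultimately show ?thesis by (auto simp: c_def rr)
  qed
  \<comment> \<open>On \<open>F\<close> the map \<open>a\<close> is the rotation
    \<open>a \<circ> p\<close> applied after \<open>p\<close>, so the colour changes exactly
    once.\<close>
  have "c (a x) \<noteq> c x" if x: "x \<in> F" for x
    using rot[of "p x"] flip[OF x] x by (simp add: involutions_simps)
  then show ?thesis using flip by blast
qed

end

subsection \<open>Ribbon subgraphs\<close>

abbreviation flags_on :: "('v, 'e, 'f) rgraph \<Rightarrow> 'e set \<Rightarrow> 'f set" where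
  "flags_on G B \<equiv> {x \<in> flags G. edge_of G x \<in> B}"

text \<open>The flags met by the loop that computes the free arcs of a ribbon subgraph with edges \<open>B\<close>.\<close>

inductive arc_walk :: "('v, 'e, 'f) rgraph \<Rightarrow> 'e set \<Rightarrow> 'f \<Rightarrow> 'f \<Rightarrow> bool"
  for G B x where
  start: "arc_walk G B x (arc G x)"
| skip: "arc_walk G B x y \<Longrightarrow> edge_of G y \<notin> B \<Longrightarrow> arc_walk G B x (arc G (seg G y))"

lemma sub_rgraph_sel [simp]:
  "verts (sub_rgraph G W B) = W"
  "edges (sub_rgraph G W B) = B"
  "flags (sub_rgraph G W B) = flags_on G B"
  "x \<in> flags G \<Longrightarrow> edge_of G x \<in> B \<Longrightarrow> vert_of (sub_rgraph G W B) x = vert_of G x"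
  "x \<in> flags G \<Longrightarrow> edge_of G x \<in> B \<Longrightarrow> edge_of (sub_rgraph G W B) x = edge_of G x"
  "x \<in> flags G \<Longrightarrow> edge_of G x \<in> B \<Longrightarrow> seg (sub_rgraph G W B) x = seg G x"
  "x \<in> flags G \<Longrightarrow> edge_of G x \<in> B \<Longrightarrow> side (sub_rgraph G W B) x = side G x"
  by (simp_all add: sub_rgraph_def Let_def)

text \<open>Every skipped flag satisfies the loop guard, so \<open>while\<close> has the same value
  at all flags of the walk. Unfolding along a known walk needs no separate termination
  argument.\<close>

lemma arc_sub_rgraph:
  assumes "x \<in> flags_on G B" "arc_walk G B x y" "edge_of G y \<in> B"
  shows "arc (sub_rgraph G W B) x = y"
proof -
  let ?w = "while (\<lambda>y. edge_of G y \<notin> B) (\<lambda>y. arc G (seg G y))"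
  have "?w (arc G x) = ?w y"
    using assms(2)
  proof induction
    case (skip y)
    then show ?case by (subst (asm) (2) while_unfold) simp
  qed simp
  also have "?w y = y" using assms(3) by (subst while_unfold) simp
  finally show ?thesis using assms(1) by (simp add: sub_rgraph_def)
qed

text \<open>A walk for \<open>B\<close> skips only edges outside \<open>B\<close>, hence outside
  \<open>B'\<close>; the loop for the smaller edge set merely runs further.\<close>

lemma arc_walk_mono:
  assumes "arc_walk G B x y" "B' \<subseteq> B"
  shows "arc_walk G B' x y"
  using assms(1) by induction (use assms(2) in \<open>auto intro: arc_walk.intros\<close>)

lemma arc_walk_append:
  assumes "arc_walk G B x y" "edge_of G y \<notin> B" "arc_walk G B (seg G y) z"
  shows "arc_walk G B x z"
  using assms(3) by induction (use assms(1,2) in \<open>auto intro: arc_walk.intros\<close>)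

section \<open>Free arcs and orbits of ribbon subgraphs\<close>

context ribbon_graph
begin

lemma vert_seg [simp]: "x \<in> flags G \<Longrightarrow> vert_of G (seg G x) = vert_of G x"
  using vertex_disc[of x] orbit_of_step[OF orbit_of_refl, of "seg G" "{seg G, arc G}" x] by auto

lemma vert_arc [simp]: "x \<in> flags G \<Longrightarrow> vert_of G (arc G x) = vert_of G x"
  using vertex_disc[of x] orbit_of_step[OF orbit_of_refl, of "arc G" "{seg G, arc G}" x] by auto

lemma edge_seg [simp]: "x \<in> flags G \<Longrightarrow> edge_of G (seg G x) = edge_of G x"
  using edge_disc[of x] by blast

lemma edge_side [simp]: "x \<in> flags G \<Longrightarrow> edge_of G (side G x) = edge_of G x"
  using edge_disc[of x] by blast

lemma edge_in: "x \<in> flags G \<Longrightarrow> edge_of G x \<in> edges G"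
  using edge_of_image by blast

lemma edge_disc_distinct:
  assumes "x \<in> flags G"
  shows "seg G x \<noteq> x" "side G x \<noteq> x" "seg G x \<noteq> side G x"
    "seg G (side G x) \<noteq> x" "seg G (side G x) \<noteq> seg G x" "seg G (side G x) \<noteq> side G x"
proof -
  have "card {x, seg G x, side G x, seg G (side G x)} = 4"
    using edge_card[OF assms] edge_disc[OF assms] by simp
  then show "seg G x \<noteq> x" "side G x \<noteq> x" "seg G x \<noteq> side G x"
    "seg G (side G x) \<noteq> x" "seg G (side G x) \<noteq> seg G x" "seg G (side G x) \<noteq> side G x"
    by (auto simp: card_insert_if split: if_splits)
qed

text \<open>On a circle of four flags, the side partner of \<open>seg G x\<close> is the one flag
  left after the other three are excluded. This commutation lets segments and sides change roles in
  the partial dual.\<close>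

lemma side_seg: assumes "x \<in> flags G" shows "side G (seg G x) = seg G (side G x)"
proof -
  have s: "seg G x \<in> flags G" using seg_in assms .
  have "side G (seg G x) \<in> {y \<in> flags G. edge_of G y = edge_of G x}"
    using s assms by (simp add: side_in)
  then have "side G (seg G x) \<in> {x, seg G x, side G x, seg G (side G x)}"
    unfolding edge_disc[OF assms] .
  moreover have "side G (seg G x) \<noteq> x" "side G (seg G x) \<noteq> seg G x" "side G (seg G x) \<noteq> side G x"
    using edge_disc_distinct[OF s] edge_disc_distinct(3)[OF assms] side_side[OF s] side_side[OF assms]
      seg_seg[OF assms] by metis+
  ultimately show ?thesis by blast
qed

text \<open>Such a colouring is a choice of orientation for each vertex disc. It supplies the parity
  argument for free arcs and the reference against which orientations of subgraphs are
  measured.\<close>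

lemma vertex_colouring:
  obtains c :: "'f \<Rightarrow> bool" where
    "\<And>x. x \<in> flags G \<Longrightarrow> c (seg G x) \<noteq> c x" "\<And>x. x \<in> flags G \<Longrightarrow> c (arc G x) \<noteq> c x"
proof -
  have "\<exists>c :: 'f \<Rightarrow> bool. \<forall>x\<in>flags G. c (seg G x) \<noteq> c x \<and> c (arc G x) \<noteq> c x"
    by (rule two_coloring)
      (auto simp: involutive_on_def seg_in arc_in seg_seg arc_arc edge_disc_distinct arc_neq)
  then show ?thesis using that by blast
qed

lemma arc_walk_in: "arc_walk G B x y \<Longrightarrow> x \<in> flags G \<Longrightarrow> y \<in> flags G"
  by (induction rule: arc_walk.induct) (auto simp: seg_in arc_in)

text \<open>The walk begins with one arc, and each skip adds a segment and an arc, so the number of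
  colour changes is odd.\<close>

lemma arc_walk_alternates:
  fixes c :: "'f \<Rightarrow> bool"
  assumes "arc_walk G B x y" "x \<in> flags G"
    and "\<And>x. x \<in> flags G \<Longrightarrow> c (seg G x) \<noteq> c x" "\<And>x. x \<in> flags G \<Longrightarrow> c (arc G x) \<noteq> c x"
  shows "c y \<noteq> c x"
  using assms(1)
proof induction
  case (skip y)
  then have "y \<in> flags G" using arc_walk_in assms(2) by blast
  then show ?case using skip assms(3)[of y] assms(4)[of "seg G y"] seg_in by blast
qed (use assms in auto)

text \<open>Reversal has to start from the last skip, so the statement carries a partial reverse
  walk from \<open>u\<close> that has already reached \<open>arc G y\<close>. The case
  \<open>u = y\<close> is the full reversal.\<close>

lemma arc_walk_reverse:
  assumes "arc_walk G B x y" "x \<in> flags G" "arc_walk G B u (arc G y)"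
  shows "arc_walk G B u x"
  using assms(1,3)
proof induction
  case (skip y)
  have y: "y \<in> flags G" using arc_walk_in skip assms by blast
  then have "arc_walk G B u (seg G y)" using skip by (simp add: seg_in arc_arc)
  then have "arc_walk G B u (arc G (seg G (seg G y)))"
    using skip y by (intro arc_walk.skip) auto
  then show ?case using skip y by (simp add: seg_seg)
qed (use assms(2) in \<open>simp add: arc_arc\<close>)

text \<open>Otherwise \<open>arc \<circ> seg\<close> would permute the finitely many flags of the walk, so the walk would
  contain the predecessor \<open>seg G x\<close> of its first flag.\<close>

lemma arc_walk_reaches:
  assumes "x \<in> flags_on G B"
  obtains y where "arc_walk G B x y" "edge_of G y \<in> B"
proof (rule ccontr)
  assume "\<not> thesis"
  then have out: "edge_of G y \<notin> B" if "arc_walk G B x y" for y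
    using that \<open>\<And>y. arc_walk G B x y \<Longrightarrow> edge_of G y \<in> B \<Longrightarrow> thesis\<close> by blast
  have x: "x \<in> flags G" using assms by simp
  let ?Z = "{z. arc_walk G B x z}" and ?r = "\<lambda>z. arc G (seg G z)"
  have Z: "?Z \<subseteq> flags G" using arc_walk_in x by blast
  then have fin: "finite ?Z" using finite_flags finite_subset by blast
  have sub: "?r ` ?Z \<subseteq> ?Z" using out by (auto intro: arc_walk.skip)
  have inj: "?r u = ?r v \<longleftrightarrow> u = v" if "u \<in> flags G" "v \<in> flags G" for u v
    using that seg_in arc_arc seg_seg by metis
  have "inj_on ?r ?Z" using inj Z by (auto simp: inj_on_def)
  then have "?r ` ?Z = ?Z" using endo_inj_surj fin sub by blast
  moreover have "arc G x \<in> ?Z" by (simp add: arc_walk.start)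
  ultimately obtain z where z: "z \<in> ?Z" "arc G x = ?r z" by blast
  have zF: "z \<in> flags G" using z Z by blast
  have "?r (seg G x) = ?r z" using z(2) x by (simp add: seg_seg)
  then have "z = seg G x" using inj[of "seg G x" z] zF seg_in x by blast
  then show False using out[of "seg G x"] z(1) assms by auto
qed

lemma arc_walk_sub:
  assumes "x \<in> flags_on G B"
  shows "arc_walk G B x (arc (sub_rgraph G W B) x)" "arc (sub_rgraph G W B) x \<in> flags_on G B"
proof -
  obtain y where "arc_walk G B x y" "edge_of G y \<in> B" using arc_walk_reaches assms by blast
  then show "arc_walk G B x (arc (sub_rgraph G W B) x)" "arc (sub_rgraph G W B) x \<in> flags_on G B"
    using arc_sub_rgraph[OF assms] arc_walk_in assms by (auto simp del: sub_rgraph_sel)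
qed

lemma arc_sub_invol:
  assumes "x \<in> flags_on G B"
  shows "arc (sub_rgraph G W B) (arc (sub_rgraph G W B) x) = x"
proof -
  let ?y = "arc (sub_rgraph G W B) x"
  have "arc_walk G B ?y x"
    using arc_walk_reverse[OF arc_walk_sub(1)[OF assms, of W], of ?y] arc_walk.start[of G B ?y] assms by simp
  then show ?thesis using arc_sub_rgraph[OF arc_walk_sub(2)[OF assms]] assms by simp
qed

text \<open>Used with \<open>p = seg G\<close> for the vertices and with \<open>p = across G B\<close> for the boundary components
  of a ribbon subgraph.\<close>

lemma orbit_sub:
  assumes x: "x \<in> flags_on G B"
    and p_in: "\<And>z. z \<in> flags_on G B \<Longrightarrow> p z \<in> flags_on G B"
    and p_out: "\<And>z. z \<in> flags G \<Longrightarrow> edge_of G z \<notin> B \<Longrightarrow> p z = seg G z"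
  shows "orbit_of {p, arc (sub_rgraph G W B)} x = orbit_of {p, arc G} x \<inter> flags_on G B"
proof (intro equalityI subsetI)
  let ?a = "arc (sub_rgraph G W B)"
  fix y assume "y \<in> orbit_of {p, ?a} x"
  then show "y \<in> orbit_of {p, arc G} x \<inter> flags_on G B"
  proof (induction rule: orbit_of_induct)
    case (step z f)
    then have z: "z \<in> orbit_of {p, arc G} x" "z \<in> flags_on G B" by auto
    have walk: "u \<in> orbit_of {p, arc G} x" if "arc_walk G B z u" for u
      using that
    proof induction
      case start
      then show ?case using z by (simp add: orbit_of_step)
    next
      case (skip u)
      have "p u \<in> orbit_of {p, arc G} x" using skip by (simp add: orbit_of_step)
      moreover have "p u = seg G u" using p_out skip arc_walk_in z by auto
      ultimately show ?case using orbit_of_step[of "seg G u" "{p, arc G}" x "arc G"] by simp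
    qed
    show ?case
    proof (cases "f = p")
      case True
      then show ?thesis using p_in[OF z(2)] orbit_of_step[OF z(1), of p] by simp
    next
      case False
      then have "f = ?a" using step by simp
      then show ?thesis using arc_walk_sub[OF z(2)] walk by blast
    qed
  qed (use x in simp)
next
  let ?a = "arc (sub_rgraph G W B)"
  let ?O = "orbit_of {p, ?a} x"
  have OB: "?O \<subseteq> flags_on G B"
    by (rule orbit_of_subset[OF x]) (use p_in arc_walk_sub(2) in blast)
  fix y assume y: "y \<in> orbit_of {p, arc G} x \<inter> flags_on G B"
  \<comment> \<open>A walk lists only the flag by which it enters a skipped segment, whereas the
    orbit in \<open>G\<close> also contains the exit. Off \<open>B\<close> the invariant therefore
    accepts \<open>z\<close> if either end of its segment is listed.\<close>
  define inv where "inv z \<longleftrightarrow> z \<in> flags G \<and> (if edge_of G z \<in> B then z \<in> ?O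
     else \<exists>w\<in>?O. arc_walk G B w z \<or> arc_walk G B w (seg G z))" for z
  have walk_inv: "inv z" if "w \<in> ?O" "arc_walk G B w z" for w z
  proof -
    have w: "w \<in> flags_on G B" using that OB by blast
    then have "z \<in> flags G" using arc_walk_in that by blast
    moreover have "z \<in> ?O" if "edge_of G z \<in> B"
      using arc_sub_rgraph[OF w \<open>arc_walk G B w z\<close> that] orbit_of_step[OF \<open>w \<in> ?O\<close>, of ?a] by simp
    ultimately show ?thesis using that by (auto simp: inv_def)
  qed
  have "y \<in> orbit_of {p, arc G} x" using y by blast
  then have "inv y"
  proof (induction rule: orbit_of_induct)
    case refl
    then show ?case using x by (simp add: inv_def)
  next
    case (step z f)
    have z: "z \<in> flags G" using step(3) by (simp add: inv_def)
    show ?case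
    proof (cases "edge_of G z \<in> B")
      case True
      then have zO: "z \<in> ?O" using step(3) by (simp add: inv_def)
      have "inv (p z)"
        using orbit_of_step[OF zO, of p] p_in[of z] z True by (simp add: inv_def)
      moreover have "inv (arc G z)" using walk_inv[OF zO arc_walk.start] .
      ultimately show ?thesis using step(2) by auto
    next
      case False
      then obtain w where w: "w \<in> ?O" "arc_walk G B w z \<or> arc_walk G B w (seg G z)"
        using step(3) by (auto simp: inv_def)
      have wF: "w \<in> flags G" using w OB by blast
      have "inv (seg G z)"
        using w False z by (auto simp: inv_def seg_in seg_seg)
      moreover have "inv (arc G z)" using w(2)
      proof
        assume "arc_walk G B w (seg G z)"
        then have "arc_walk G B w (arc G (seg G (seg G z)))"
          using False z by (intro arc_walk.skip) auto
        then show ?thesis using walk_inv[OF w(1)] z by (simp add: seg_seg)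
      next
        \<comment> \<open>From an entered flag, \<open>arc G\<close> leads back along the walk: to
          \<open>w\<close> itself, or to the exit of the previously skipped segment.\<close>
        assume "arc_walk G B w z"
        then show ?thesis
        proof cases
          case start
          then have "arc G z = w" using wF arc_arc by simp
          then show ?thesis using w(1) OB by (auto simp: inv_def)
        next
          case (skip u)
          have u: "u \<in> flags G" using arc_walk_in skip wF by blast
          then have "arc G z = seg G u" using skip by (simp add: seg_in arc_arc)
          then show ?thesis using skip u w(1) by (auto simp: inv_def seg_in seg_seg)
        qed
      qed
      ultimately show ?thesis using step(2) p_out[OF z False] by auto
    qed
  qed
  then show "y \<in> ?O" using y by (simp add: inv_def)
qed

text \<open>The edge discs are untouched; only the free arcs change. Shortcutting a vertex circle
  past the removed flags leaves one circle, by \<open>orbit_sub\<close>, and parity excludes a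
  shortcut from a flag to itself.\<close>

lemma ribbon_graph_sub:
  assumes "W \<subseteq> verts G" "B \<subseteq> edges G" "ends G B \<subseteq> W"
  shows "ribbon_graph (sub_rgraph G W B)"
proof
  let ?H = "sub_rgraph G W B"
  show "finite (verts ?H)" using finite_verts assms finite_subset by auto
  show "finite (flags ?H)" using finite_flags by simp
  show "edge_of ?H ` flags ?H = edges ?H"
  proof -
    have "edge_of ?H ` flags ?H = edge_of G ` flags_on G B" by (rule image_cong) auto
    also have "\<dots> = B" using assms(2) edge_of_image by auto
    finally show ?thesis by simp
  qed
  fix x assume "x \<in> flags ?H"
  then have x: "x \<in> flags_on G B" by simp
  then have xF: "x \<in> flags G" "edge_of G x \<in> B" by auto
  show "vert_of ?H x \<in> verts ?H" using assms(3) xF by (auto simp: ends_def)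
  show "seg ?H x \<in> flags ?H" "side ?H x \<in> flags ?H" "seg ?H (seg ?H x) = x"
    "side ?H (side ?H x) = x"
    using xF by (simp_all add: seg_in side_in seg_seg side_side)
  show "arc ?H x \<in> flags ?H" "arc ?H (arc ?H x) = x"
    using arc_walk_sub(2)[OF x] arc_sub_invol[OF x] by simp_all
  show "arc ?H x \<noteq> x"
    using arc_walk_alternates[OF arc_walk_sub(1)[OF x] xF(1)] vertex_colouring by metis
  have eq: "{y \<in> flags ?H. edge_of ?H y = edge_of ?H x} = {y \<in> flags G. edge_of G y = edge_of G x}"
    using xF by auto
  show "{y \<in> flags ?H. edge_of ?H y = edge_of ?H x} = {x, seg ?H x, side ?H x, seg ?H (side ?H x)}"
    unfolding eq using edge_disc xF by (simp add: side_in)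
  show "card {y \<in> flags ?H. edge_of ?H y = edge_of ?H x} = 4"
    unfolding eq using edge_card xF by simp
  have "orbit_of {seg ?H, arc ?H} x = orbit_of {seg G, arc ?H} x"
    by (rule orbit_of_cong[OF x]) (use arc_walk_sub(2)[of _ B W] seg_in in auto)
  also have "\<dots> = orbit_of {seg G, arc G} x \<inter> flags_on G B"
    by (rule orbit_sub[OF x]) (auto simp: seg_in)
  also have "\<dots> = {y \<in> flags G. vert_of G y = vert_of G x} \<inter> flags_on G B"
    using vertex_disc[OF xF(1)] by simp
  also have "\<dots> = {y \<in> flags ?H. vert_of ?H y = vert_of ?H x}"
    using xF by auto
  finally show "{y \<in> flags ?H. vert_of ?H y = vert_of ?H x} = orbit_of {seg ?H, arc ?H} x" ..
qed

text \<open>A free arc of the nested subgraph is a concatenation of free arcs of the middle one,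
  each of which expands to a walk in \<open>G\<close>. Equality of records, and not only
  isomorphism, is what \<open>ribbon_subgraph\<close> demands.\<close>

lemma sub_sub_rgraph:
  assumes "W \<subseteq> verts G" "B \<subseteq> edges G" "ends G B \<subseteq> W" and "B' \<subseteq> B"
  shows "sub_rgraph (sub_rgraph G W B) W' B' = sub_rgraph G W' B'"
proof -
  let ?K = "sub_rgraph G W B"
  interpret K: ribbon_graph ?K by (rule ribbon_graph_sub[OF assms(1-3)])
  have F: "flags_on ?K B' = flags_on G B'" using assms(4) by auto
  have walk: "arc_walk G B' x y" if x: "x \<in> flags_on G B'" and "arc_walk ?K B' x y" for x y
    using that(2)
  proof induction
    case start
    show ?case using arc_walk_mono[OF arc_walk_sub(1)] x assms(4) by blast
  next
    case (skip z)
    have "z \<in> flags ?K" using K.arc_walk_in[OF skip(1)] x assms(4) by auto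
    then have z: "z \<in> flags G" "edge_of G z \<in> B" by auto
    then have "seg G z \<in> flags_on G B" by (simp add: seg_in)
    then have "arc_walk G B' (seg G z) (arc ?K (seg G z))"
      using arc_walk_mono[OF arc_walk_sub(1)] assms(4) by blast
    then show ?case using arc_walk_append skip z by auto
  qed
  have "arc (sub_rgraph ?K W' B') x = arc (sub_rgraph G W' B') x" if x: "x \<in> flags_on G B'" for x
  proof -
    have xK: "x \<in> flags_on ?K B'" using x F by blast
    let ?y = "arc (sub_rgraph ?K W' B') x"
    have "?y \<in> flags_on G B'" using K.arc_walk_sub(2)[OF xK] F by blast
    moreover have "arc_walk G B' x ?y" using walk[OF x K.arc_walk_sub(1)[OF xK]] .
    ultimately show ?thesis using arc_sub_rgraph[OF x] by auto
  qed
  moreover have "arc (sub_rgraph ?K W' B') x = arc (sub_rgraph G W' B') x"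
    if "x \<notin> flags_on G B'" for x
    unfolding sub_rgraph_def[of ?K] sub_rgraph_def[of G W' B'] Let_def F using that by auto
  ultimately have arcs: "arc (sub_rgraph ?K W' B') = arc (sub_rgraph G W' B')" by blast
  have "vert_of (sub_rgraph ?K W' B') = vert_of (sub_rgraph G W' B')"
    "edge_of (sub_rgraph ?K W' B') = edge_of (sub_rgraph G W' B')"
    "seg (sub_rgraph ?K W' B') = seg (sub_rgraph G W' B')"
    "side (sub_rgraph ?K W' B') = side (sub_rgraph G W' B')"
    unfolding sub_rgraph_def[of ?K] sub_rgraph_def[of G W' B'] Let_def F
    using assms(4) by (auto intro!: ext)
  then show ?thesis using arcs F by (intro rgraph.equality) auto
qed

end

subsection \<open>Components and the Euler genus\<close>

definition vclass :: "('v, 'e, 'f) rgraph \<Rightarrow> 'v \<Rightarrow> 'v set" where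
  "vclass G u = {v \<in> verts G. (u, v) \<in> (adj G)\<^sup>*}"

definition edges_at :: "('v, 'e, 'f) rgraph \<Rightarrow> 'v set \<Rightarrow> 'e set" where
  "edges_at G C = edge_of G ` {x \<in> flags G. vert_of G x \<in> C}"

lemma component_of_eq: "component_of G u = sub_rgraph G (vclass G u) (edges_at G (vclass G u))"
  by (simp add: component_of_def vclass_def edges_at_def Let_def)

lemma components_eq: "components G = (\<lambda>C. sub_rgraph G C (edges_at G C)) ` vclass G ` verts G"
  by (auto simp: components_def component_of_eq)

text \<open>The vertex set can be read off the record, so components may be counted and summed
  through their vertex classes.\<close>

lemma inj_sub_rgraph: "inj_on (\<lambda>C. sub_rgraph G C (f C)) S"
  by (rule inj_onI, drule arg_cong[where f = verts]) simp

lemma card_components: "card (components G) = card (vclass G ` verts G)"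
  unfolding components_eq
  by (rule card_image[OF inj_sub_rgraph])

context ribbon_graph
begin

lemma adj_sym: "sym (adj G)"
proof (rule symI)
  fix u v assume "(u, v) \<in> adj G"
  then obtain x where "x \<in> flags G" "u = vert_of G x" "v = vert_of G (side G x)"
    by (auto simp: adj_def)
  then show "(v, u) \<in> adj G"
    unfolding adj_def using side_in side_side by (metis (mono_tags, lifting) CollectI)
qed

lemma adj_reach_sym: "(u, v) \<in> (adj G)\<^sup>* \<Longrightarrow> (v, u) \<in> (adj G)\<^sup>*"
  using sym_rtrancl[OF adj_sym] by (rule symD)

lemma vclass_refl: "u \<in> verts G \<Longrightarrow> u \<in> vclass G u"
  by (simp add: vclass_def)

lemma vclass_eq: "v \<in> vclass G u \<Longrightarrow> vclass G v = vclass G u"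
  unfolding vclass_def
  by (auto elim: rtrancl_trans) (metis adj_reach_sym rtrancl_trans)

lemma vclass_disjoint:
  assumes "C \<in> vclass G ` verts G" "D \<in> vclass G ` verts G" "v \<in> C" "v \<in> D"
  shows "C = D"
proof -
  obtain u w where "C = vclass G u" "D = vclass G w" using assms(1,2) by blast
  then show ?thesis using vclass_eq[of v u] vclass_eq[of v w] assms(3,4) by simp
qed

lemma Union_vclass: "\<Union> (vclass G ` verts G) = verts G"
  using vclass_refl by (auto simp: vclass_def)

lemma finite_edges: "finite (edges G)"
  using edge_of_image finite_flags by (metis finite_imageI)

lemma vclass_side:
  assumes "C \<in> vclass G ` verts G" "x \<in> flags G"
  shows "vert_of G (side G x) \<in> C \<longleftrightarrow> vert_of G x \<in> C"
proof -
  obtain u where u: "C = vclass G u" using assms by blast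
  have step: "vert_of G (side G y) \<in> C" if "y \<in> flags G" "vert_of G y \<in> C" for y
  proof -
    have "(vert_of G y, vert_of G (side G y)) \<in> adj G" using that by (auto simp: adj_def)
    then show ?thesis using that u vert_of_in side_in by (auto simp: vclass_def)
  qed
  show ?thesis using step[of x] step[of "side G x"] assms side_in side_side by auto
qed

text \<open>All four flags of an edge disc lie over one class, since \<open>seg\<close> preserves
  the vertex and \<open>side\<close> the class.\<close>

lemma edges_at_vclass:
  assumes "C \<in> vclass G ` verts G" "x \<in> flags G"
  shows "edge_of G x \<in> edges_at G C \<longleftrightarrow> vert_of G x \<in> C"
proof
  assume "edge_of G x \<in> edges_at G C"
  then obtain y where y: "y \<in> flags G" "vert_of G y \<in> C" "edge_of G x = edge_of G y"
    by (auto simp: edges_at_def)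
  then have "x \<in> {y, seg G y, side G y, seg G (side G y)}"
    using edge_disc[OF y(1)] assms(2) by blast
  then show "vert_of G x \<in> C" using y vclass_side[OF assms(1)] side_in by auto
qed (use assms in \<open>auto simp: edges_at_def\<close>)

lemma flags_on_edges_at:
  "C \<in> vclass G ` verts G \<Longrightarrow> flags_on G (edges_at G C) = {x \<in> flags G. vert_of G x \<in> C}"
  using edges_at_vclass by auto

lemma ends_edges_at: "C \<in> vclass G ` verts G \<Longrightarrow> ends G (edges_at G C) \<subseteq> C"
  unfolding ends_def flags_on_edges_at by auto

lemma edges_at_subset: "edges_at G C \<subseteq> edges G"
  by (auto simp: edges_at_def edge_in)

text \<open>A component keeps every edge at its vertices, so the loop stops at its first
  flag.\<close>

lemma arc_component:
  assumes "C \<in> vclass G ` verts G" "x \<in> flags G" "vert_of G x \<in> C"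
  shows "arc (sub_rgraph G C (edges_at G C)) x = arc G x"
proof (rule arc_sub_rgraph)
  show "x \<in> flags_on G (edges_at G C)" using assms flags_on_edges_at by blast
  show "edge_of G (arc G x) \<in> edges_at G C" using assms edges_at_vclass arc_in by simp
qed (rule arc_walk.start)

section \<open>Boundary components of components and of ribbon subgraphs\<close>

lemma involutive_across: "involutive_on (flags G) {across G B, arc G}"
  by (auto simp: involutive_on_def across_def seg_in side_in arc_in seg_seg side_side arc_arc)

text \<open>Over a class both boundary maps agree with those of \<open>G\<close>, so the boundary
  orbits are the same sets of flags. The components thus partition
  \<open>boundary_comps G (edges G)\<close> literally, without a bijection.\<close>

lemma boundary_comps_component:
  assumes C: "C \<in> vclass G ` verts G"
  shows "boundary_comps (sub_rgraph G C (edges_at G C)) (edges_at G C) =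
    Inl ` orbit_of {across G (edges G), arc G} ` {x \<in> flags G. vert_of G x \<in> C} \<union>
    Inr ` (isolated_verts G \<inter> C)"
proof -
  let ?H = "sub_rgraph G C (edges_at G C)" and ?F = "{x \<in> flags G. vert_of G x \<in> C}"
  have F: "flags ?H = ?F" using flags_on_edges_at[OF C] by simp
  have "orbit_of {across ?H (edges_at G C), arc ?H} x = orbit_of {across G (edges G), arc G} x"
    if "x \<in> ?F" for x
  proof (rule orbit_of_cong[OF that])
    fix z assume z: "z \<in> ?F"
    then have zE: "edge_of G z \<in> edges_at G C" using edges_at_vclass[OF C] by blast
    have 1: "arc ?H z = arc G z" using arc_component[OF C] z by simp
    have 2: "across ?H (edges_at G C) z = side G z" "across G (edges G) z = side G z"
      using z zE edge_in by (simp_all add: across_def)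
    show "across ?H (edges_at G C) z = across G (edges G) z \<and> arc ?H z = arc G z \<and>
      across ?H (edges_at G C) z \<in> ?F \<and> arc ?H z \<in> ?F"
      unfolding 1 2 using z vclass_side[OF C] side_in arc_in by simp
  qed
  then have orb: "orbit_of {across ?H (edges_at G C), arc ?H} ` ?F =
      orbit_of {across G (edges G), arc G} ` ?F"
    by (rule image_cong[OF refl])
  have "vert_of ?H ` flags ?H = vert_of G ` ?F"
    unfolding F by (rule image_cong[OF refl]) (use edges_at_vclass[OF C] in auto)
  then have "isolated_verts ?H = isolated_verts G \<inter> C"
    using C by (auto simp: isolated_verts_def vclass_def)
  then show ?thesis unfolding boundary_comps_def F orb by simp
qed

lemma finite_boundary_comps: "finite (boundary_comps G A)"
  using finite_flags finite_verts by (simp add: boundary_comps_def isolated_verts_def)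

lemma boundary_orbit_vclass:
  assumes C: "C \<in> vclass G ` verts G" and "x \<in> flags G" "vert_of G x \<in> C"
  shows "orbit_of {across G A, arc G} x \<subseteq> {x \<in> flags G. vert_of G x \<in> C}"
  by (rule orbit_of_subset)
    (use assms vclass_side[OF C] in \<open>auto simp: across_def side_in seg_in arc_in\<close>)

lemma Union_boundary_comps_component:
  "(\<Union>C\<in>vclass G ` verts G. boundary_comps (sub_rgraph G C (edges_at G C)) (edges_at G C)) =
    boundary_comps G (edges G)" (is "?L = ?R")
proof -
  have cov: "\<exists>C\<in>vclass G ` verts G. v \<in> C" if "v \<in> verts G" for v
    using Union_vclass that by blast
  show ?thesis
  proof (intro equalityI subsetI)
    fix b assume "b \<in> ?L"
    then obtain C where C: "C \<in> vclass G ` verts G"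
      and "b \<in> boundary_comps (sub_rgraph G C (edges_at G C)) (edges_at G C)" by blast
    then have "b \<in> Inl ` orbit_of {across G (edges G), arc G} ` {x \<in> flags G. vert_of G x \<in> C} \<union>
        Inr ` (isolated_verts G \<inter> C)"
      unfolding boundary_comps_component[OF C] by simp
    then show "b \<in> ?R" unfolding boundary_comps_def by auto
  next
    fix b assume "b \<in> ?R"
    then consider x where "x \<in> flags G" "b = Inl (orbit_of {across G (edges G), arc G} x)"
      | v where "v \<in> isolated_verts G" "b = Inr v"
      by (auto simp: boundary_comps_def)
    then show "b \<in> ?L"
    proof cases
      case 1
      obtain C where C: "C \<in> vclass G ` verts G" "vert_of G x \<in> C"
        using cov[OF vert_of_in[OF 1(1)]] by blast
      then have "b \<in> boundary_comps (sub_rgraph G C (edges_at G C)) (edges_at G C)"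
        unfolding boundary_comps_component[OF C(1)] using 1 by blast
      then show ?thesis using C(1) by blast
    next
      case 2
      have "v \<in> verts G" using 2(1) by (simp add: isolated_verts_def)
      then obtain C where C: "C \<in> vclass G ` verts G" "v \<in> C" using cov by blast
      then have "b \<in> boundary_comps (sub_rgraph G C (edges_at G C)) (edges_at G C)"
        unfolding boundary_comps_component[OF C(1)] using 2 by blast
      then show ?thesis using C(1) by blast
    qed
  qed
qed

lemma boundary_comps_component_disjoint:
  assumes C: "C \<in> vclass G ` verts G" and D: "D \<in> vclass G ` verts G" and "C \<noteq> D"
  shows "boundary_comps (sub_rgraph G C (edges_at G C)) (edges_at G C) \<inter>
    boundary_comps (sub_rgraph G D (edges_at G D)) (edges_at G D) = {}"
proof -
  have CD: "C \<inter> D = {}" using assms vclass_disjoint by blast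
  have "orbit_of {across G (edges G), arc G} x \<noteq> orbit_of {across G (edges G), arc G} y"
    if "x \<in> flags G" "vert_of G x \<in> C" "y \<in> flags G" "vert_of G y \<in> D" for x y
  proof
    assume "orbit_of {across G (edges G), arc G} x = orbit_of {across G (edges G), arc G} y"
    then have "x \<in> orbit_of {across G (edges G), arc G} y" using orbit_of_refl by metis
    then have "vert_of G x \<in> D" using boundary_orbit_vclass[OF D that(3,4)] by blast
    then show False using CD that by blast
  qed
  then show ?thesis
    unfolding boundary_comps_component[OF C] boundary_comps_component[OF D] using CD by auto
qed

text \<open>Both branches of \<open>genus\<close> contribute \<open>2 - euler_char\<close> per
  component. Vertices, edges and boundary components are each partitioned by the components, so the
  three sums collapse to global counts.\<close>

lemma euler_genus_eq:
  "euler_genus G = 2 * of_nat (card (components G)) - of_nat (card (verts G))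
    + of_nat (card (edges G)) - of_nat (card (boundary_comps G (edges G)))"
proof -
  let ?P = "vclass G ` verts G" and ?H = "\<lambda>C. sub_rgraph G C (edges_at G C)"
  let ?b = "\<lambda>C. boundary_comps (?H C) (edges_at G C)"
  have finP: "finite ?P" using finite_verts by simp
  have V: "(\<Sum>C\<in>?P. card C) = card (verts G)"
  proof -
    have "card (\<Union>C\<in>?P. C) = (\<Sum>C\<in>?P. card C)"
    proof (rule card_UN_disjoint[OF finP])
      show "\<forall>C\<in>?P. finite C" using finite_verts by (auto simp: vclass_def)
      show "\<forall>C\<in>?P. \<forall>D\<in>?P. C \<noteq> D \<longrightarrow> C \<inter> D = {}" using vclass_disjoint by blast
    qed
    then show ?thesis using Union_vclass by simp
  qed
  have E: "(\<Sum>C\<in>?P. card (edges_at G C)) = card (edges G)"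
  proof -
    have "card (\<Union>C\<in>?P. edges_at G C) = (\<Sum>C\<in>?P. card (edges_at G C))"
    proof (rule card_UN_disjoint[OF finP])
      show "\<forall>C\<in>?P. finite (edges_at G C)"
        using finite_edges edges_at_subset finite_subset by blast
      show "\<forall>C\<in>?P. \<forall>D\<in>?P. C \<noteq> D \<longrightarrow> edges_at G C \<inter> edges_at G D = {}"
      proof (intro ballI impI)
        fix C D assume CD: "C \<in> ?P" "D \<in> ?P" "C \<noteq> D"
        show "edges_at G C \<inter> edges_at G D = {}"
        proof (rule ccontr)
          assume "edges_at G C \<inter> edges_at G D \<noteq> {}"
          then obtain x where x: "x \<in> flags G" "vert_of G x \<in> C" "edge_of G x \<in> edges_at G D"
            by (auto simp: edges_at_def)
          then have "vert_of G x \<in> D" using edges_at_vclass[OF CD(2)] by simp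
          then show False using vclass_disjoint CD x by blast
        qed
      qed
    qed
    moreover have "(\<Union>C\<in>?P. edges_at G C) = edges G"
    proof
      show "(\<Union>C\<in>?P. edges_at G C) \<subseteq> edges G" using edges_at_subset by blast
      show "edges G \<subseteq> (\<Union>C\<in>?P. edges_at G C)"
      proof
        fix e assume "e \<in> edges G"
        then obtain x where x: "x \<in> flags G" "e = edge_of G x" using edge_of_image by blast
        then obtain C where "C \<in> ?P" "vert_of G x \<in> C" using Union_vclass vert_of_in by blast
        then show "e \<in> (\<Union>C\<in>?P. edges_at G C)" using x by (auto simp: edges_at_def)
      qed
    qed
    ultimately show ?thesis by simp
  qed
  have Bd: "(\<Sum>C\<in>?P. card (?b C)) = card (boundary_comps G (edges G))"
  proof -
    have "card (\<Union>C\<in>?P. ?b C) = (\<Sum>C\<in>?P. card (?b C))"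
    proof (rule card_UN_disjoint[OF finP])
      show "\<forall>C\<in>?P. finite (?b C)"
      proof
        fix C assume "C \<in> ?P"
        then have "?b C \<subseteq> boundary_comps G (edges G)"
          using Union_boundary_comps_component by blast
        then show "finite (?b C)" using finite_boundary_comps finite_subset by blast
      qed
      show "\<forall>C\<in>?P. \<forall>D\<in>?P. C \<noteq> D \<longrightarrow> ?b C \<inter> ?b D = {}"
        using boundary_comps_component_disjoint by blast
    qed
    then show ?thesis using Union_boundary_comps_component by simp
  qed
  have inj: "inj_on ?H ?P" by (rule inj_sub_rgraph)
  have "euler_genus G = (\<Sum>H\<in>components G. 2 - euler_char H)"
    unfolding euler_genus_def by (rule sum.cong) (auto simp: genus_def)
  also have "\<dots> = (\<Sum>C\<in>?P. 2 - euler_char (?H C))"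
    unfolding components_eq using sum.reindex[OF inj] by (simp add: o_def)
  also have "\<dots> = (\<Sum>C\<in>?P. 2 - of_nat (card C) + of_nat (card (edges_at G C)) - of_nat (card (?b C)))"
    by (rule sum.cong) (simp_all add: euler_char_def)
  also have "\<dots> = 2 * of_nat (card ?P) - of_nat (\<Sum>C\<in>?P. card C)
      + of_nat (\<Sum>C\<in>?P. card (edges_at G C)) - of_nat (\<Sum>C\<in>?P. card (?b C))"
    by (simp add: sum.distrib sum_subtractf)
  finally show ?thesis unfolding V E Bd card_components .
qed

text \<open>A boundary curve either runs along an edge of \<open>B\<close> or circles a vertex
  meeting none. Only the first kind survives as flag orbits in \<open>sub_rgraph\<close>; the second
  is carried there by an isolated vertex or is lost with its vertex.\<close>

lemma boundary_orbits_split: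
  fixes B
  defines "Orb \<equiv> orbit_of {across G B, arc G}"
  shows "Orb ` flags G = Orb ` flags_on G B \<union>
      (\<lambda>v. {y \<in> flags G. vert_of G y = v}) ` (vert_of G ` flags G - ends G B)"
    and "Orb ` flags_on G B \<inter>
      (\<lambda>v. {y \<in> flags G. vert_of G y = v}) ` (vert_of G ` flags G - ends G B) = {}"
proof -
  \<comment> \<open>On a closed set of flags off \<open>B\<close> only \<open>seg\<close> and
    \<open>arc\<close> act, so an orbit inside it is a full vertex circle.\<close>
  have seg_orbit: "Orb x = {y \<in> flags G. vert_of G y = vert_of G x}"
    if x: "x \<in> flags G" and F0: "x \<in> F0" "F0 \<subseteq> flags G" "F0 \<inter> flags_on G B = {}"
      and closed: "\<And>z. z \<in> F0 \<Longrightarrow> across G B z \<in> F0 \<and> arc G z \<in> F0" for x F0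
  proof -
    have "Orb x = orbit_of {seg G, arc G} x"
      unfolding Orb_def
    proof (rule orbit_of_cong[OF F0(1)])
      fix z assume z: "z \<in> F0"
      then have "across G B z = seg G z" using F0 by (auto simp: across_def)
      then show "across G B z = seg G z \<and> arc G z = arc G z \<and> across G B z \<in> F0 \<and> arc G z \<in> F0"
        using closed[OF z] by simp
    qed
    then show ?thesis using vertex_disc x by simp
  qed
  have out: "Orb x = {y \<in> flags G. vert_of G y = vert_of G x}"
    if x: "x \<in> flags G" "vert_of G x \<notin> ends G B" for x
  proof -
    have notB: "edge_of G z \<notin> B" if "z \<in> {y \<in> flags G. vert_of G y = vert_of G x}" for z
    proof
      assume "edge_of G z \<in> B"
      then have "vert_of G z \<in> ends G B" using that unfolding ends_def by blast
      then show False using that x(2) by simp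
    qed
    show ?thesis
    proof (rule seg_orbit[OF x(1), of "{y \<in> flags G. vert_of G y = vert_of G x}"])
      show "{y \<in> flags G. vert_of G y = vert_of G x} \<inter> flags_on G B = {}"
        using notB by blast
      fix z assume z: "z \<in> {y \<in> flags G. vert_of G y = vert_of G x}"
      then show "across G B z \<in> {y \<in> flags G. vert_of G y = vert_of G x} \<and>
          arc G z \<in> {y \<in> flags G. vert_of G y = vert_of G x}"
        using notB[OF z] z by (simp add: across_def seg_in arc_in)
    qed (use x in auto)
  qed
  \<comment> \<open>A curve avoiding \<open>B\<close> would be a whole vertex circle, and so would
    contain the flag of \<open>B\<close> at that vertex.\<close>
  have in_ends: "Orb x \<in> Orb ` flags_on G B" if x: "x \<in> flags G" "vert_of G x \<in> ends G B" for x
  proof (rule ccontr)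
    assume neg: "Orb x \<notin> Orb ` flags_on G B"
    have sub: "Orb x \<subseteq> flags G"
      unfolding Orb_def using involutive_orbit_subset[OF involutive_across x(1)] .
    have disj: "Orb x \<inter> flags_on G B = {}"
      using neg orbit_of_eq[OF involutive_across x(1), of _ B] unfolding Orb_def by blast
    have "Orb x = {y \<in> flags G. vert_of G y = vert_of G x}"
      by (rule seg_orbit[OF x(1) _ sub disj]) (auto simp: Orb_def orbit_of_step)
    moreover obtain y where "y \<in> flags_on G B" "vert_of G y = vert_of G x"
      using x(2) by (auto simp: ends_def)
    ultimately show False using disj by blast
  qed
  show "Orb ` flags G = Orb ` flags_on G B \<union>
      (\<lambda>v. {y \<in> flags G. vert_of G y = v}) ` (vert_of G ` flags G - ends G B)" (is "_ = _ \<union> ?R")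
  proof (intro equalityI subsetI)
    fix b assume "b \<in> Orb ` flags G"
    then obtain x where "x \<in> flags G" "b = Orb x" by blast
    then show "b \<in> Orb ` flags_on G B \<union> ?R"
      using out[of x] in_ends[of x] by blast
  next
    fix b assume "b \<in> Orb ` flags_on G B \<union> ?R"
    then show "b \<in> Orb ` flags G"
    proof
      assume "b \<in> ?R"
      then obtain x where "x \<in> flags G" "vert_of G x \<notin> ends G B"
        "b = {y \<in> flags G. vert_of G y = vert_of G x}" by blast
      then show ?thesis using out[of x] by blast
    qed blast
  qed
  show "Orb ` flags_on G B \<inter> ?R = {}"
  proof (rule ccontr)
    assume "Orb ` flags_on G B \<inter> ?R \<noteq> {}"
    then obtain x v where x: "x \<in> flags_on G B" "v \<notin> ends G B"
      "Orb x = {y \<in> flags G. vert_of G y = v}" by auto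
    have "x \<in> Orb x" by (simp add: Orb_def)
    then have "vert_of G x = v" using x(3) by simp
    then show False using x(1,2) by (auto simp: ends_def)
  qed
qed

lemma card_boundary_comps:
  "card (boundary_comps G B) =
    card (orbit_of {across G B, arc G} ` flags G) + card (isolated_verts G)"
proof -
  have "finite (isolated_verts G)" using finite_verts by (simp add: isolated_verts_def)
  then show ?thesis unfolding boundary_comps_def using finite_flags
    by (subst card_Un_disjoint) (auto simp: card_image inj_on_def)
qed

text \<open>Cutting boundary orbits down to the flags of \<open>B\<close> matches the curves along
  edges of \<open>B\<close> bijectively; each vertex outside \<open>W\<close> accounts for one lost
  circle.\<close>

lemma card_boundary_comps_sub:
  assumes "W \<subseteq> verts G" "B \<subseteq> edges G" "ends G B \<subseteq> W"
  shows "card (boundary_comps (sub_rgraph G W B) B) + card (verts G - W) = card (boundary_comps G B)"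
proof -
  let ?H = "sub_rgraph G W B"
  let ?O = "orbit_of {across G B, arc G}" and ?O' = "orbit_of {across ?H B, arc ?H}"
  let ?R = "(\<lambda>v. {y \<in> flags G. vert_of G y = v}) ` (vert_of G ` flags G - ends G B)"
  interpret H: ribbon_graph ?H by (rule ribbon_graph_sub[OF assms])
  have O': "?O' x = ?O x \<inter> flags_on G B" if x: "x \<in> flags_on G B" for x
  proof -
    have "?O' x = orbit_of {across G B, arc ?H} x"
      by (rule orbit_of_cong[OF x])
        (use arc_walk_sub(2)[of _ B W] side_in in \<open>auto simp: across_def\<close>)
    also have "\<dots> = ?O x \<inter> flags_on G B"
      by (rule orbit_sub[OF x]) (auto simp: across_def side_in)
    finally show ?thesis .
  qed
  have "bij_betw (\<lambda>X. X \<inter> flags_on G B) (?O ` flags_on G B) (?O' ` flags_on G B)"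
  proof (rule bij_betw_imageI)
    show "inj_on (\<lambda>X. X \<inter> flags_on G B) (?O ` flags_on G B)"
    proof (rule inj_onI)
      fix X Y assume "X \<in> ?O ` flags_on G B" "Y \<in> ?O ` flags_on G B"
        and eq: "X \<inter> flags_on G B = Y \<inter> flags_on G B"
      then obtain x y where x: "x \<in> flags_on G B" "X = ?O x" and y: "y \<in> flags_on G B" "Y = ?O y"
        by blast
      have "x \<in> ?O x" by simp
      then have "x \<in> ?O y" using eq x y by blast
      then show "X = Y" using orbit_of_eq[OF involutive_across, of y x] x y by blast
    qed
    show "(\<lambda>X. X \<inter> flags_on G B) ` ?O ` flags_on G B = ?O' ` flags_on G B"
      unfolding image_image by (rule image_cong[OF refl]) (rule O'[symmetric])
  qed
  then have orb: "card (?O ` flags_on G B) = card (?O' ` flags_on G B)"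
    by (rule bij_betw_same_card)
  have R: "card ?R = card (vert_of G ` flags G - ends G B)"
    by (rule card_image) (auto simp: inj_on_def)
  have "card (?O ` flags G) = card (?O ` flags_on G B) + card ?R"
    unfolding boundary_orbits_split(1)[of B]
    by (rule card_Un_disjoint) (use finite_flags boundary_orbits_split(2)[of B] in auto)
  \<comment> \<open>A vertex without an edge of \<open>B\<close> bounds one circle, whether it
    carries other flags or is isolated already in \<open>G\<close>.\<close>
  moreover have "card (vert_of G ` flags G - ends G B) + card (isolated_verts G) = card (verts G - ends G B)"
  proof -
    have "verts G - ends G B = (vert_of G ` flags G - ends G B) \<union> isolated_verts G"
      using vert_of_in by (auto simp: isolated_verts_def ends_def)
    moreover have "(vert_of G ` flags G - ends G B) \<inter> isolated_verts G = {}"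
      by (auto simp: isolated_verts_def)
    ultimately show ?thesis
      using finite_flags finite_verts by (simp add: card_Un_disjoint isolated_verts_def)
  qed
  ultimately have "card (boundary_comps G B) = card (?O' ` flags_on G B) + card (verts G - ends G B)"
    unfolding card_boundary_comps using orb R by simp
  moreover have "isolated_verts ?H = W - ends G B"
  proof -
    have "vert_of ?H ` flags ?H = ends G B"
      unfolding ends_def sub_rgraph_sel by (rule image_cong) auto
    then show ?thesis by (simp add: isolated_verts_def)
  qed
  then have "card (boundary_comps ?H B) = card (?O' ` flags_on G B) + card (W - ends G B)"
    using H.card_boundary_comps[of B] by simp
  moreover have "card (verts G - ends G B) = card (W - ends G B) + card (verts G - W)"
  proof -
    have "verts G - ends G B = (W - ends G B) \<union> (verts G - W)" using assms by blast
    then show ?thesis using finite_verts assms(1)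
      by (simp add: card_Un_disjoint finite_subset Diff_Int_distrib2 disjoint_iff)
  qed
  ultimately show ?thesis by simp
qed

lemma adj_sub: "adj (sub_rgraph G W B) = {(vert_of G x, vert_of G (side G x)) | x. x \<in> flags_on G B}"
  unfolding adj_def sub_rgraph_sel setcompr_eq_image
  by (rule image_cong) (auto simp: side_in)

text \<open>Adjacency in the subgraph touches only \<open>ends G B\<close>, so each other vertex of
  \<open>W\<close> is a component by itself.\<close>

lemma card_components_sub:
  assumes "W \<subseteq> verts G" "B \<subseteq> edges G" "ends G B \<subseteq> W"
  shows "card (components (sub_rgraph G W B)) =
    card (components (sub_rgraph G (ends G B) B)) + card (W - ends G B)"
proof -
  let ?H = "sub_rgraph G W B" and ?K = "sub_rgraph G (ends G B) B"
  have A: "adj ?H = adj ?K" by (simp add: adj_sub)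
  have sub: "u \<in> ends G B \<and> v \<in> ends G B" if "(u, v) \<in> adj ?K" for u v
    using that by (auto simp: adj_sub ends_def side_in)
  have reach: "v = u \<or> u \<in> ends G B \<and> v \<in> ends G B" if "(u, v) \<in> (adj ?K)\<^sup>*" for u v
    using that by induction (use sub in auto)
  have 1: "vclass ?H u = vclass ?K u" if "u \<in> ends G B" for u
    using that assms(3) reach by (auto simp: vclass_def A)
  have 2: "vclass ?H u = {u}" if "u \<in> W - ends G B" for u
    using that reach by (auto simp: vclass_def A)
  have "vclass ?H ` W = vclass ?H ` (ends G B \<union> (W - ends G B))" using assms(3) by (metis Diff_partition)
  also have "\<dots> = vclass ?K ` ends G B \<union> (\<lambda>u. {u}) ` (W - ends G B)"
    unfolding image_Un using 1 2 by simp
  finally have eq: "vclass ?H ` W = vclass ?K ` ends G B \<union> (\<lambda>u. {u}) ` (W - ends G B)" .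
  have fin: "finite W" using assms(1) finite_verts finite_subset by blast
  have "vclass ?K u \<subseteq> ends G B" for u by (auto simp: vclass_def)
  then have "vclass ?K ` ends G B \<inter> (\<lambda>u. {u}) ` (W - ends G B) = {}" by blast
  then have "card (vclass ?H ` W) = card (vclass ?K ` ends G B) + card ((\<lambda>u. {u}) ` (W - ends G B))"
    unfolding eq using fin finite_subset[OF assms(3) fin] by (intro card_Un_disjoint) auto
  then show ?thesis unfolding card_components by (simp add: card_image)
qed

end

subsection \<open>Partial duals and orientability\<close>

lemma partial_dual_sel [simp]:
  "verts (partial_dual G A) = boundary_comps G A"
  "edges (partial_dual G A) = edges G"
  "flags (partial_dual G A) = flags G"
  "vert_of (partial_dual G A) x = Inl (orbit_of {across G A, arc G} x)"
  "edge_of (partial_dual G A) = edge_of G"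
  "seg (partial_dual G A) = across G A"
  "side (partial_dual G A) x = (if edge_of G x \<in> A then seg G x else side G x)"
  "arc (partial_dual G A) = arc G"
  by (simp_all add: partial_dual_def)

context ribbon_graph
begin

lemma ribbon_graph_partial_dual: "ribbon_graph (partial_dual G A)"
proof
  let ?D = "partial_dual G A"
  show "finite (verts ?D)" using finite_boundary_comps by simp
  show "finite (flags ?D)" using finite_flags by simp
  show "edge_of ?D ` flags ?D = edges ?D" using edge_of_image by simp
  fix x assume "x \<in> flags ?D"
  then have x: "x \<in> flags G" by simp
  show "vert_of ?D x \<in> verts ?D" using x by (simp add: boundary_comps_def)
  show "seg ?D x \<in> flags ?D" "side ?D x \<in> flags ?D" "arc ?D x \<in> flags ?D"
    "seg ?D (seg ?D x) = x" "side ?D (side ?D x) = x" "arc ?D (arc ?D x) = x" "arc ?D x \<noteq> x"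
    using x by (simp_all add: across_def seg_in side_in arc_in seg_seg side_side arc_arc arc_neq)
  \<comment> \<open>On edges of \<open>A\<close> the roles of \<open>seg\<close> and
    \<open>side\<close> are exchanged; \<open>side_seg\<close> identifies the fourth flag.\<close>
  show "{y \<in> flags ?D. edge_of ?D y = edge_of ?D x} = {x, seg ?D x, side ?D x, seg ?D (side ?D x)}"
    using edge_disc[OF x] x side_seg[OF x] by (auto simp: across_def)
  show "card {y \<in> flags ?D. edge_of ?D y = edge_of ?D x} = 4"
    using edge_card[OF x] by simp
  show "{y \<in> flags ?D. vert_of ?D y = vert_of ?D x} = orbit_of {seg ?D, arc ?D} x"
  proof (intro equalityI subsetI)
    fix y assume "y \<in> {y \<in> flags ?D. vert_of ?D y = vert_of ?D x}"
    then have "orbit_of {across G A, arc G} y = orbit_of {across G A, arc G} x" by simp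
    then show "y \<in> orbit_of {seg ?D, arc ?D} x" using orbit_of_refl[of y "{across G A, arc G}"] by simp
  next
    fix y assume "y \<in> orbit_of {seg ?D, arc ?D} x"
    then have y: "y \<in> orbit_of {across G A, arc G} x" by simp
    then show "y \<in> {y \<in> flags ?D. vert_of ?D y = vert_of ?D x}"
      using orbit_of_eq[OF involutive_across x y] involutive_orbit_subset[OF involutive_across x] by auto
  qed
qed

text \<open>At each flag the three maps are the same up to exchanging \<open>seg\<close> and
  \<open>side\<close>, and the orientability condition is symmetric in them.\<close>

lemma orientable_partial_dual: "orientable (partial_dual G A) \<longleftrightarrow> orientable G"
proof -
  have "(s (seg (partial_dual G A) x) \<noteq> s x \<and> s (side (partial_dual G A) x) \<noteq> s x \<and>
      s (arc (partial_dual G A) x) \<noteq> s x) \<longleftrightarrow>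
    (s (seg G x) \<noteq> s x \<and> s (side G x) \<noteq> s x \<and> s (arc G x) \<noteq> s x)" for s :: "'f \<Rightarrow> bool" and x
    by (auto simp: across_def)
  then show ?thesis unfolding orientable_def partial_dual_sel(3) by simp
qed

section \<open>Connectivity of the partial dual\<close>

lemma connected_components:
  assumes "connected_rgraph G" shows "card (components G) = 1"
proof -
  have "vclass G ` verts G = {verts G}"
    using assms by (auto simp: connected_rgraph_def vclass_def)
  then show ?thesis by (simp add: card_components)
qed

lemma connected_no_isolated:
  assumes "connected_rgraph G" "flags G \<noteq> {}"
  shows "vert_of G ` flags G = verts G"
proof
  show "vert_of G ` flags G \<subseteq> verts G" using vert_of_in by blast
  show "verts G \<subseteq> vert_of G ` flags G"
  proof
    fix v assume v: "v \<in> verts G"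
    obtain x where x: "x \<in> flags G" using assms(2) by blast
    have "(vert_of G x, v) \<in> (adj G)\<^sup>*"
      using assms(1) v vert_of_in[OF x] by (simp add: connected_rgraph_def)
    then show "v \<in> vert_of G ` flags G"
    proof cases
      case base then show ?thesis using x by blast
    next
      case (step y) then show ?thesis using side_in by (auto simp: adj_def)
    qed
  qed
qed

lemma same_vertex_orbit:
  assumes "x \<in> flags G" "y \<in> flags G" "vert_of G y = vert_of G x"
  shows "y \<in> orbit_of {seg G, side G, arc G} x"
proof -
  have "y \<in> orbit_of {seg G, arc G} x" using vertex_disc assms by blast
  then show ?thesis by (induction rule: orbit_of_induct) (auto simp: orbit_of_step)
qed

text \<open>Duality changes the vertices but only permutes the three involutions at each flag, so
  connectivity is passed to the partial dual in this flag form.\<close>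

lemma connected_flag_orbit:
  assumes "connected_rgraph G" "x \<in> flags G" "y \<in> flags G"
  shows "y \<in> orbit_of {seg G, side G, arc G} x"
proof -
  have "(vert_of G x, vert_of G y) \<in> (adj G)\<^sup>*"
    using assms vert_of_in by (simp add: connected_rgraph_def)
  then have "\<forall>z\<in>flags G. vert_of G z = vert_of G y \<longrightarrow> z \<in> orbit_of {seg G, side G, arc G} x"
  proof (induction rule: rtrancl_induct)
    case base
    then show ?case using same_vertex_orbit assms(2) by blast
  next
    case (step u v)
    then obtain w where w: "w \<in> flags G" "u = vert_of G w" "v = vert_of G (side G w)"
      by (auto simp: adj_def)
    then have "w \<in> orbit_of {seg G, side G, arc G} x" using step(3) by blast
    then have "side G w \<in> orbit_of {seg G, side G, arc G} x" by (simp add: orbit_of_step)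
    then show ?case
      using same_vertex_orbit[OF side_in[OF w(1)]] w(3) orbit_of_trans by metis
  qed
  then show ?thesis using assms by blast
qed

lemma connected_partial_dual:
  assumes "connected_rgraph G"
  shows "connected_rgraph (partial_dual G A)"
proof (cases "flags G = {}")
  case True
  \<comment> \<open>Without flags, \<open>G\<close> is a single vertex, and its boundary circle is
    the only vertex of the dual.\<close>
  have "(u, v) \<notin> adj G" for u v using True by (simp add: adj_def)
  then have "adj G = {}" by auto
  then obtain v where "verts G = {v}" using assms by (auto simp: connected_rgraph_def)
  then have "verts (partial_dual G A) = {Inr v}"
    using True by (simp add: boundary_comps_def isolated_verts_def)
  then show ?thesis by (simp add: connected_rgraph_def)
next
  case False
  let ?D = "partial_dual G A"
  interpret D: ribbon_graph ?D by (rule ribbon_graph_partial_dual)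
  have V: "verts ?D = vert_of ?D ` flags ?D"
    using connected_no_isolated[OF assms False]
    by (auto simp: boundary_comps_def isolated_verts_def)
  have sideD: "(vert_of ?D z, vert_of ?D (side ?D z)) \<in> (adj ?D)\<^sup>*" if "z \<in> flags G" for z
    by (rule r_into_rtrancl) (use that in \<open>auto simp: adj_def simp del: partial_dual_sel(4,7)\<close>)
  have flag_step: "(vert_of ?D z, vert_of ?D (f z)) \<in> (adj ?D)\<^sup>*"
    if z: "z \<in> flags G" and f: "f \<in> {seg G, side G, arc G}" for z f
  proof -
    \<comment> \<open>Segments and arcs of the dual stay at one dual vertex, so only a dual side can
      produce an adjacency.\<close>
    have "f z = seg ?D z \<or> f z = arc ?D z \<or> f z = side ?D z" using f by (auto simp: across_def)
    moreover have "vert_of ?D (seg ?D z) = vert_of ?D z" "vert_of ?D (arc ?D z) = vert_of ?D z"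
      using D.vert_seg D.vert_arc z by (simp_all del: partial_dual_sel(4,6,8))
    ultimately show ?thesis using sideD[OF z] by (metis rtrancl.rtrancl_refl)
  qed
  have conn: "(vert_of ?D x, vert_of ?D y) \<in> (adj ?D)\<^sup>*" if x: "x \<in> flags G" and y: "y \<in> flags G" for x y
    using connected_flag_orbit[OF assms x y]
  proof (induction rule: orbit_of_induct)
    case (step z f)
    have "orbit_of {seg G, side G, arc G} x \<subseteq> flags G"
      by (rule orbit_of_subset[OF x]) (auto simp: seg_in side_in arc_in)
    then have "(vert_of ?D z, vert_of ?D (f z)) \<in> (adj ?D)\<^sup>*" using flag_step step(1,2) by blast
    then show ?case using step(3) by (rule rtrancl_trans[rotated])
  qed simp
  show ?thesis
    unfolding connected_rgraph_def V using conn False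
    by (auto simp del: partial_dual_sel(4))
qed

section \<open>Euler genus and orientability of ribbon subgraphs\<close>

lemma ends_subset: "ends G B \<subseteq> verts G"
  using vert_of_in by (auto simp: ends_def)

text \<open>Isolated vertices have Euler genus \<open>0\<close>, so the Euler genus does not depend on \<open>W\<close>.\<close>

lemma euler_genus_sub:
  assumes "W \<subseteq> verts G" "B \<subseteq> edges G" "ends G B \<subseteq> W"
  shows "euler_genus (sub_rgraph G W B) = 2 * of_nat (card (components (sub_rgraph G (verts G) B)))
    - of_nat (card (verts G)) + of_nat (card B) - of_nat (card (boundary_comps G B))"
proof -
  interpret H: ribbon_graph "sub_rgraph G W B" by (rule ribbon_graph_sub[OF assms])
  have W: "card (verts G - ends G B) = card (W - ends G B) + card (verts G - W)"
  proof -
    have "verts G - ends G B = (W - ends G B) \<union> (verts G - W)" using assms by blast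
    then show ?thesis using finite_verts finite_subset[OF assms(1)]
      by (simp add: card_Un_disjoint disjoint_iff)
  qed
  have V: "card (verts G) = card W + card (verts G - W)"
    using card_Diff_subset[OF finite_subset[OF assms(1) finite_verts] assms(1)] card_mono[OF finite_verts assms(1)]
    by simp
  have b: "of_nat (card (boundary_comps G B)) =
      (of_nat (card (boundary_comps (sub_rgraph G W B) B)) + of_nat (card (verts G - W)) :: rat)"
    using card_boundary_comps_sub[OF assms] by (metis of_nat_add)
  have k: "card (components (sub_rgraph G (verts G) B)) =
      card (components (sub_rgraph G W B)) + card (verts G - W)"
    using card_components_sub[OF assms] card_components_sub[OF order_refl assms(2) ends_subset] W
    by simp
  \<comment> \<open>Each vertex outside \<open>W\<close> adds one component, one vertex and one
    boundary circle to the spanning subgraph: a change of 2 - 1 - 1 = 0.\<close>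
  show ?thesis unfolding H.euler_genus_eq sub_rgraph_sel b k V by simp
qed

text \<open>An orientation of \<open>G\<close> alternates along segments and arcs, so it changes an
  odd number of times along the walk that forms a new free arc.\<close>

lemma orientable_sub:
  assumes "orientable G"
  shows "orientable (sub_rgraph G W B)"
proof -
  obtain s :: "'f \<Rightarrow> bool" where s: "\<forall>x\<in>flags G. s (seg G x) \<noteq> s x \<and> s (side G x) \<noteq> s x \<and> s (arc G x) \<noteq> s x"
    using assms unfolding orientable_def by (rule exE)
  have "s (arc (sub_rgraph G W B) x) \<noteq> s x" if "x \<in> flags_on G B" for x
    using arc_walk_alternates[OF arc_walk_sub(1)[OF that], of s] that s by blast
  then have "\<forall>x\<in>flags (sub_rgraph G W B). s (seg (sub_rgraph G W B) x) \<noteq> s x \<and>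
      s (side (sub_rgraph G W B) x) \<noteq> s x \<and> s (arc (sub_rgraph G W B) x) \<noteq> s x"
    using s by simp
  then show ?thesis unfolding orientable_def by (rule exI[of _ s])
qed

lemma orientable_sub_verts:
  "orientable (sub_rgraph G W B) \<longleftrightarrow> orientable (sub_rgraph G W' B)"
proof -
  have "arc (sub_rgraph G W B) = arc (sub_rgraph G W' B)" by (simp add: sub_rgraph_def Let_def)
  then show ?thesis by (simp add: orientable_def)
qed

text \<open>An orientation of a ribbon subgraph agrees, up to a sign at each vertex, with a fixed
  colouring of the flags alternating around the vertices.\<close>

lemma orientation_vertex_sign:
  fixes c s :: "'f \<Rightarrow> bool"
  assumes H: "W \<subseteq> verts G" "B \<subseteq> edges G" "ends G B \<subseteq> W"
    and c: "\<And>x. x \<in> flags G \<Longrightarrow> c (seg G x) \<noteq> c x" "\<And>x. x \<in> flags G \<Longrightarrow> c (arc G x) \<noteq> c x"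
    and s: "\<And>x. x \<in> flags_on G B \<Longrightarrow> s (seg G x) \<noteq> s x"
      "\<And>x. x \<in> flags_on G B \<Longrightarrow> s (arc (sub_rgraph G W B) x) \<noteq> s x"
    and xy: "x \<in> flags_on G B" "y \<in> flags_on G B" "vert_of G x = vert_of G y"
  shows "(s x = c x) = (s y = c y)"
proof -
  let ?H = "sub_rgraph G W B"
  interpret H: ribbon_graph ?H by (rule ribbon_graph_sub[OF H])
  have orb: "y \<in> orbit_of {seg ?H, arc ?H} x"
    using H.vertex_disc[of x] xy by (simp add: set_eq_iff) (metis sub_rgraph_sel(4))
  have sub: "orbit_of {seg ?H, arc ?H} x \<subseteq> flags_on G B"
    using orbit_of_subset[of x "flags ?H" "{seg ?H, arc ?H}"] xy(1) H.seg_in H.arc_in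
    unfolding sub_rgraph_sel(3) by blast
  from orb have "(s y = c y) = (s x = c x)"
  proof (induction rule: orbit_of_induct)
    case (step z f)
    have z: "z \<in> flags_on G B" using step(1) sub by blast
    have "c (arc ?H z) \<noteq> c z" using arc_walk_alternates[OF arc_walk_sub(1)[OF z]] z c by blast
    moreover have "c (seg ?H z) \<noteq> c z" "s (seg ?H z) \<noteq> s z"
      using z c(1)[of z] s(1)[of z] by simp_all
    moreover have "f = seg ?H \<or> f = arc ?H" using step(2) by blast
    ultimately have "(s (f z) = c (f z)) = (s z = c z)" using s(2)[OF z] by metis
    then show ?case using step(3) by simp
  qed simp
  then show ?thesis by simp
qed

text \<open>The summands share only \<open>v\<close>, so reversing all of \<open>Q\<close> when the
  signs at \<open>v\<close> differ makes the sign constant at every vertex of \<open>G\<close>. This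
  controls the arcs of \<open>G\<close> that join a flag of \<open>P\<close> to a flag of
  \<open>Q\<close>, which neither orientation sees.\<close>

lemma orientable_one_sum:
  assumes "n_sum 1 G P Q" "orientable P" "orientable Q"
  shows "orientable G"
proof -
  have n: "ribbon_subgraph P G" "ribbon_subgraph Q G" "edges P \<union> edges Q = edges G"
    "edges P \<inter> edges Q = {}" "card (verts P \<inter> verts Q) = 1"
    using assms(1) by (auto simp: n_sum_def)
  obtain v where v: "verts P \<inter> verts Q = {v}" using n(5) by (auto simp: card_1_singleton_iff)
  have P: "verts P \<subseteq> verts G" "edges P \<subseteq> edges G" "ends G (edges P) \<subseteq> verts P"
      "P = sub_rgraph G (verts P) (edges P)"
    and Q: "verts Q \<subseteq> verts G" "edges Q \<subseteq> edges G" "ends G (edges Q) \<subseteq> verts Q"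
      "Q = sub_rgraph G (verts Q) (edges Q)"
    using n(1,2) by (auto simp: ribbon_subgraph_def)
  obtain c :: "'f \<Rightarrow> bool" where c: "\<And>x. x \<in> flags G \<Longrightarrow> c (seg G x) \<noteq> c x" "\<And>x. x \<in> flags G \<Longrightarrow> c (arc G x) \<noteq> c x"
    using vertex_colouring by blast
  have orient: "\<exists>s :: 'f \<Rightarrow> bool. (\<forall>x\<in>flags_on G B. s (seg G x) \<noteq> s x \<and> s (side G x) \<noteq> s x \<and>
      s (arc (sub_rgraph G W B) x) \<noteq> s x)" if o: "orientable (sub_rgraph G W B)" for W B
  proof -
    obtain s :: "'f \<Rightarrow> bool" where s: "\<forall>x\<in>flags (sub_rgraph G W B). s (seg (sub_rgraph G W B) x) \<noteq> s x \<and>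
      s (side (sub_rgraph G W B) x) \<noteq> s x \<and> s (arc (sub_rgraph G W B) x) \<noteq> s x"
      using o unfolding orientable_def by (rule exE)
    then have "\<forall>x\<in>flags_on G B. s (seg G x) \<noteq> s x \<and> s (side G x) \<noteq> s x \<and>
      s (arc (sub_rgraph G W B) x) \<noteq> s x" by simp
    then show ?thesis by (rule exI[of _ s])
  qed
  have oP: "orientable (sub_rgraph G (verts P) (edges P))" using assms(2) by (subst P(4)[symmetric])
  have oQ: "orientable (sub_rgraph G (verts Q) (edges Q))" using assms(3) by (subst Q(4)[symmetric])
  obtain p :: "'f \<Rightarrow> bool" where p: "\<forall>x\<in>flags_on G (edges P). p (seg G x) \<noteq> p x \<and> p (side G x) \<noteq> p x \<and>
      p (arc (sub_rgraph G (verts P) (edges P)) x) \<noteq> p x"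
    using orient[OF oP] by (rule exE)
  obtain q :: "'f \<Rightarrow> bool" where q: "\<forall>x\<in>flags_on G (edges Q). q (seg G x) \<noteq> q x \<and> q (side G x) \<noteq> q x \<and>
      q (arc (sub_rgraph G (verts Q) (edges Q)) x) \<noteq> q x"
    using orient[OF oQ] by (rule exE)
  have pc: "(p x = c x) = (p y = c y)"
    if "x \<in> flags_on G (edges P)" "y \<in> flags_on G (edges P)" "vert_of G x = vert_of G y" for x y
    by (rule orientation_vertex_sign[OF P(1-3) c, of p]) (use p that in blast)+
  have qc: "(q x = c x) = (q y = c y)"
    if "x \<in> flags_on G (edges Q)" "y \<in> flags_on G (edges Q)" "vert_of G x = vert_of G y" for x y
    by (rule orientation_vertex_sign[OF Q(1-3) c, of q]) (use q that in blast)+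
  \<comment> \<open>One disagreeing pair decides for all, since \<open>pc\<close> and
    \<open>qc\<close> make each sign constant at \<open>v\<close>.\<close>
  define flip where "flip \<longleftrightarrow> (\<exists>x\<in>flags_on G (edges P). \<exists>y\<in>flags_on G (edges Q).
      vert_of G x = v \<and> vert_of G y = v \<and> (p x = c x) \<noteq> (q y = c y))"
  define s where "s x \<longleftrightarrow> (if edge_of G x \<in> edges P then p x else q x \<noteq> flip)" for x
  have inP: "x \<in> flags_on G (edges P)" if "x \<in> flags G" "edge_of G x \<in> edges P" for x using that by simp
  have inQ: "x \<in> flags_on G (edges Q)" if "x \<in> flags G" "edge_of G x \<notin> edges P" for x
    using that n(3) edge_in by auto
  have cross: "(p x = c x) = ((q y \<noteq> flip) = c y)"
    if x: "x \<in> flags_on G (edges P)" and y: "y \<in> flags_on G (edges Q)" and xy: "vert_of G x = vert_of G y" for x y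
  proof -
    have "vert_of G x \<in> verts P" "vert_of G y \<in> verts Q" using x y P(3) Q(3) by (auto simp: ends_def)
    then have vv: "vert_of G x = v" "vert_of G y = v" using v xy by auto
    show ?thesis
    proof (cases flip)
      case True
      then obtain x' y' where "x' \<in> flags_on G (edges P)" "y' \<in> flags_on G (edges Q)"
        "vert_of G x' = v" "vert_of G y' = v" "(p x' = c x') \<noteq> (q y' = c y')"
        unfolding flip_def by blast
      then show ?thesis using pc[OF x, of x'] qc[OF y, of y'] vv True by metis
    next
      case False
      then show ?thesis using x y vv unfolding flip_def by blast
    qed
  qed
  have sc: "(s x = c x) = (s y = c y)" if "x \<in> flags G" "y \<in> flags G" "vert_of G x = vert_of G y" for x y
  proof (cases "edge_of G x \<in> edges P"; cases "edge_of G y \<in> edges P")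
    assume "edge_of G x \<in> edges P" "edge_of G y \<in> edges P"
    then show ?thesis using pc[OF inP[of x] inP[of y]] that by (simp add: s_def)
  next
    assume *: "edge_of G x \<in> edges P" "edge_of G y \<notin> edges P"
    then show ?thesis using cross[OF inP[of x] inQ[of y]] that by (simp add: s_def)
  next
    assume *: "edge_of G x \<notin> edges P" "edge_of G y \<in> edges P"
    then show ?thesis using cross[OF inP[of y] inQ[of x]] that by (simp add: s_def)
  next
    assume *: "edge_of G x \<notin> edges P" "edge_of G y \<notin> edges P"
    then have "(q x = c x) = (q y = c y)" using qc[OF inQ[of x] inQ[of y]] that by blast
    then show ?thesis using * by (cases "q x"; cases "q y"; cases "c x") (simp_all add: s_def)
  qed
  have "s (seg G x) \<noteq> s x \<and> s (side G x) \<noteq> s x \<and> s (arc G x) \<noteq> s x" if x: "x \<in> flags G" for x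
  proof -
    \<comment> \<open>Both ends of an arc are at one vertex, and \<open>c\<close> differs at them;
      equal signs make \<open>s\<close> differ as well.\<close>
    have "(s x = c x) = (s (arc G x) = c (arc G x))"
      using sc[OF x arc_in[OF x]] vert_arc[OF x] by simp
    then have "s (arc G x) \<noteq> s x" using c(2)[OF x] by (cases "s x"; cases "c x") simp_all
    moreover have "s (seg G x) \<noteq> s x \<and> s (side G x) \<noteq> s x"
    proof (cases "edge_of G x \<in> edges P")
      case True
      then show ?thesis using bspec[OF p inP[OF x]] x by (simp add: s_def)
    next
      case False
      then show ?thesis using bspec[OF q inQ[OF x]] x by (simp add: s_def)
    qed
    ultimately show ?thesis by blast
  qed
  then show ?thesis unfolding orientable_def by (intro exI[of _ s] ballI)
qed

end

lemma one_sum_seq_orientable: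
  assumes "one_sum_seq Hs G" "ribbon_graph G" "\<forall>H\<in>set Hs. orientable H"
  shows "orientable G"
  using assms
proof (induction rule: one_sum_seq.induct)
  case (step Hs K G H)
  interpret ribbon_graph G by fact
  have "verts K \<subseteq> verts G" "edges K \<subseteq> edges G" "ends G (edges K) \<subseteq> verts K"
    "K = sub_rgraph G (verts K) (edges K)"
    using step(2) by (auto simp: n_sum_def ribbon_subgraph_def)
  then have "ribbon_graph K" using ribbon_graph_sub by metis
  then show ?case using orientable_one_sum[OF step(2)] step by auto
qed simp

text \<open>Each 1-sum identifies exactly one vertex. Adding the length on the left keeps the count
  free of subtraction on \<open>nat\<close>.\<close>

lemma one_sum_seq_card:
  assumes "one_sum_seq Hs G" "finite (verts G)"
  shows "Hs \<noteq> [] \<and> card (verts G) + length Hs = (\<Sum>H\<leftarrow>Hs. card (verts H)) + 1"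
  using assms
proof (induction rule: one_sum_seq.induct)
  case (step Hs K G H)
  have n: "verts K \<union> verts H = verts G" "card (verts K \<inter> verts H) = 1"
    using step(2) by (auto simp: n_sum_def)
  then have fin: "finite (verts K)" "finite (verts H)" using step(4) by (metis finite_Un)+
  then show ?case using card_Un_Int[OF fin] n step(3) by auto
qed simp

subsection \<open>Sequences of 1-sums\<close>

text \<open>As long as the list does not exhaust \<open>S\<close>, some remaining element meets a
  listed one and can be appended, until the length reaches \<open>card S\<close>. In the application
  \<open>next_summand\<close> is the connectivity of \<open>G\<close>.\<close>

lemma greedy_order:
  fixes V :: "'a \<Rightarrow> 'b set"
  assumes "finite S" "S \<noteq> {}"
    and next_summand: "\<And>T. T \<subset> S \<Longrightarrow> T \<noteq> {} \<Longrightarrow> \<exists>H\<in>S - T. \<exists>K\<in>T. V H \<inter> V K \<noteq> {}"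
  obtains Hs where "distinct Hs" "set Hs = S"
    "\<And>i. 0 < i \<Longrightarrow> i < length Hs \<Longrightarrow> \<exists>j<i. V (Hs ! i) \<inter> V (Hs ! j) \<noteq> {}"
proof -
  have "\<exists>Hs. distinct Hs \<and> set Hs \<subseteq> S \<and> length Hs = Suc n \<and>
      (\<forall>i. 0 < i \<and> i < length Hs \<longrightarrow> (\<exists>j<i. V (Hs ! i) \<inter> V (Hs ! j) \<noteq> {}))"
    if "Suc n \<le> card S" for n
    using that
  proof (induction n)
    case 0
    obtain H where "H \<in> S" using assms(2) by blast
    then show ?case by (intro exI[of _ "[H]"]) auto
  next
    case (Suc n)
    then obtain Hs where Hs: "distinct Hs" "set Hs \<subseteq> S" "length Hs = Suc n"
      "\<forall>i. 0 < i \<and> i < length Hs \<longrightarrow> (\<exists>j<i. V (Hs ! i) \<inter> V (Hs ! j) \<noteq> {})"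
      by auto
    have "card (set Hs) < card S" using Hs Suc.prems by (simp add: distinct_card)
    then have "set Hs \<subset> S" using Hs by auto
    moreover have "set Hs \<noteq> {}" using Hs(3) by auto
    ultimately obtain H K where H: "H \<in> S - set Hs" "K \<in> set Hs" "V H \<inter> V K \<noteq> {}"
      using next_summand[of "set Hs"] by blast
    then obtain j where j: "j < length Hs" "K = Hs ! j" by (metis in_set_conv_nth)
    have "\<exists>j<i. V ((Hs @ [H]) ! i) \<inter> V ((Hs @ [H]) ! j) \<noteq> {}" if i: "0 < i" "i < length (Hs @ [H])" for i
    proof (cases "i < length Hs")
      case True
      then obtain j where "j < i" "V (Hs ! i) \<inter> V (Hs ! j) \<noteq> {}" using Hs(4) i by blast
      then show ?thesis using True by (intro exI[of _ j]) (simp add: nth_append)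
    next
      case False
      then have "i = length Hs" using i by simp
      then show ?thesis using j H(3) by (intro exI[of _ j]) (simp add: nth_append)
    qed
    then show ?case using Hs H(1) by (intro exI[of _ "Hs @ [H]"]) auto
  qed
  moreover obtain n where n: "card S = Suc n" using assms(1,2) by (metis card_0_eq not0_implies_Suc)
  ultimately obtain Hs where Hs: "distinct Hs" "set Hs \<subseteq> S" "length Hs = Suc n"
    "\<forall>i. 0 < i \<and> i < length Hs \<longrightarrow> (\<exists>j<i. V (Hs ! i) \<inter> V (Hs ! j) \<noteq> {})"
    by (metis order_refl)
  have "set Hs = S" using card_subset_eq[OF assms(1) Hs(2)] Hs(1,3) n by (simp add: distinct_card)
  then show ?thesis using that Hs(1,4) by blast
qed

text \<open>Each appended set loses at least one element to the overlap. Bound and equality case are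
  proved together: total equality forces equality for the prefix and a single common element at the
  last step.\<close>

lemma overlapping_union_card:
  fixes V :: "'a \<Rightarrow> 'b set"
  assumes "Hs \<noteq> []" "\<forall>H\<in>set Hs. finite (V H)"
    and "\<forall>i. 0 < i \<and> i < length Hs \<longrightarrow> (\<exists>j<i. V (Hs ! i) \<inter> V (Hs ! j) \<noteq> {})"
  shows "card (\<Union> (V ` set Hs)) + length Hs \<le> (\<Sum>H\<leftarrow>Hs. card (V H)) + 1 \<and>
    (card (\<Union> (V ` set Hs)) + length Hs = (\<Sum>H\<leftarrow>Hs. card (V H)) + 1 \<longrightarrow>
      (\<forall>i. 0 < i \<and> i < length Hs \<longrightarrow> card (\<Union> (V ` set (take i Hs)) \<inter> V (Hs ! i)) = 1))"
  using assms
proof (induction Hs rule: rev_induct)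
  case (snoc H Hs)
  show ?case
  proof (cases "Hs = []")
    case True
    then show ?thesis by auto
  next
    case False
    let ?U = "\<Union> (V ` set Hs)"
    have prem: "\<exists>j<i. V (Hs ! i) \<inter> V (Hs ! j) \<noteq> {}" if "0 < i" "i < length Hs" for i
    proof -
      have "\<exists>j<i. V ((Hs @ [H]) ! i) \<inter> V ((Hs @ [H]) ! j) \<noteq> {}"
        by (rule snoc.prems(3)[rule_format]) (use that in simp)
      then obtain j where "j < i" "V ((Hs @ [H]) ! i) \<inter> V ((Hs @ [H]) ! j) \<noteq> {}" by blast
      then show ?thesis using that by (intro exI[of _ j]) (simp add: nth_append)
    qed
    have IH: "card ?U + length Hs \<le> (\<Sum>H\<leftarrow>Hs. card (V H)) + 1"
      "card ?U + length Hs = (\<Sum>H\<leftarrow>Hs. card (V H)) + 1 \<Longrightarrow>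
        \<forall>i. 0 < i \<and> i < length Hs \<longrightarrow> card (\<Union> (V ` set (take i Hs)) \<inter> V (Hs ! i)) = 1"
      using snoc.IH[OF False] snoc.prems(2) prem by simp_all
    have "\<exists>j<length Hs. V ((Hs @ [H]) ! length Hs) \<inter> V ((Hs @ [H]) ! j) \<noteq> {}"
      by (rule snoc.prems(3)[rule_format]) (use False in simp)
    then obtain j where j: "j < length Hs" "V ((Hs @ [H]) ! length Hs) \<inter> V ((Hs @ [H]) ! j) \<noteq> {}"
      by blast
    then have "V H \<inter> V (Hs ! j) \<noteq> {}" by (simp add: nth_append)
    then have ne: "?U \<inter> V H \<noteq> {}" using nth_mem[OF j(1)] by blast
    have fin: "finite ?U" "finite (V H)" using snoc.prems(2) by auto
    have pos: "1 \<le> card (?U \<inter> V H)" using ne fin by (simp add: Suc_le_eq card_gt_0_iff)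
    have un: "card (?U \<union> V H) + card (?U \<inter> V H) = card ?U + card (V H)"
      using card_Un_Int[OF fin] by simp
    have U: "\<Union> (V ` set (Hs @ [H])) = ?U \<union> V H" by auto
    have "card (\<Union> (V ` set (take i (Hs @ [H]))) \<inter> V ((Hs @ [H]) ! i)) = 1"
      if eq: "card (?U \<union> V H) + length (Hs @ [H]) = (\<Sum>H\<leftarrow>Hs @ [H]. card (V H)) + 1"
        and i: "0 < i" "i < length (Hs @ [H])" for i
    proof -
      have *: "card ?U + length Hs = (\<Sum>H\<leftarrow>Hs. card (V H)) + 1" "card (?U \<inter> V H) = 1"
        using eq un pos IH(1) by simp_all
      show ?thesis
      proof (cases "i < length Hs")
        case True
        then show ?thesis using IH(2)[OF *(1)] i by (simp add: nth_append)
      next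
        case False
        then have "i = length Hs" using i by simp
        then show ?thesis using *(2) by simp
      qed
    qed
    then show ?thesis unfolding U using un pos IH(1) by auto
  qed
qed simp

text \<open>These are the conditions that \<open>n_sum\<close> puts on a single summand. Even a
  connected \<open>G\<close> with edges may fail them as a record, because
  \<open>ribbon_subgraph\<close> fixes the values outside the flags.\<close>

definition proper_part :: "('v, 'e, 'f) rgraph \<Rightarrow> ('v, 'e, 'f) rgraph \<Rightarrow> bool" where
  "proper_part G H \<longleftrightarrow> ribbon_subgraph H G \<and> connected_rgraph H \<and> edges H \<noteq> {}"

section \<open>Gluing parts of \<open>G\<close> by 1-sums\<close>

context ribbon_graph
begin

lemma connected_union:
  assumes "connected_rgraph (sub_rgraph G W B)" "connected_rgraph (sub_rgraph G W' B')"
    "W \<inter> W' \<noteq> {}"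
  shows "connected_rgraph (sub_rgraph G (W \<union> W') (B \<union> B'))"
proof -
  let ?R = "(adj (sub_rgraph G (W \<union> W') (B \<union> B')))\<^sup>*"
  have mono: "(adj (sub_rgraph G W B))\<^sup>* \<subseteq> ?R" "(adj (sub_rgraph G W' B'))\<^sup>* \<subseteq> ?R"
    by (rule rtrancl_mono; auto simp: adj_sub)+
  obtain w where w: "w \<in> W" "w \<in> W'" using assms(3) by blast
  have "(u, w) \<in> ?R \<and> (w, u) \<in> ?R" if "u \<in> W \<union> W'" for u
    using that w assms(1,2) mono unfolding connected_rgraph_def sub_rgraph_sel by blast
  then have "(u, v) \<in> ?R" if "u \<in> W \<union> W'" "v \<in> W \<union> W'" for u v
    using that rtrancl_trans by metis
  then show ?thesis unfolding connected_rgraph_def sub_rgraph_sel using w by blast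
qed

lemma ends_sub: "B' \<subseteq> B \<Longrightarrow> ends (sub_rgraph G W B) B' = ends G B'"
  unfolding ends_def by (rule image_cong) auto

lemma ends_Un: "ends G (B \<union> B') = ends G B \<union> ends G B'"
  by (auto simp: ends_def)

text \<open>Each step of a sequence needs its summands inside the intermediate sum and not merely
  inside \<open>G\<close>; nested restriction provides this.\<close>

lemma ribbon_subgraph_sub:
  assumes "ribbon_subgraph H G" "W \<subseteq> verts G" "B \<subseteq> edges G" "ends G B \<subseteq> W"
    "verts H \<subseteq> W" "edges H \<subseteq> B"
  shows "ribbon_subgraph H (sub_rgraph G W B)"
proof -
  have H: "ends G (edges H) \<subseteq> verts H" "H = sub_rgraph G (verts H) (edges H)"
    using assms(1) unfolding ribbon_subgraph_def by blast+
  then have "H = sub_rgraph (sub_rgraph G W B) (verts H) (edges H)"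
    using sub_sub_rgraph[OF assms(2-4,6), of "verts H"] by metis
  then show ?thesis
    unfolding ribbon_subgraph_def sub_rgraph_sel(1,2) ends_sub[OF assms(6)]
    using assms(5,6) H(1) by blast
qed

text \<open>The sum is realised as a union inside \<open>G\<close>. The last conclusion is separate
  because \<open>sub_rgraph G (verts G) (edges G)\<close> can differ from \<open>G\<close> outside
  the flags.\<close>

lemma one_sum_parts:
  assumes P: "proper_part G P" and Q: "proper_part G Q"
    and "edges P \<inter> edges Q = {}" "card (verts P \<inter> verts Q) = 1"
  defines "K \<equiv> sub_rgraph G (verts P \<union> verts Q) (edges P \<union> edges Q)"
  shows "proper_part G K" "n_sum 1 K P Q"
    and "verts P \<union> verts Q = verts G \<Longrightarrow> edges P \<union> edges Q = edges G \<Longrightarrow> connected_rgraph G \<Longrightarrow>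
      n_sum 1 G P Q"
proof -
  have sP: "verts P \<subseteq> verts G" "edges P \<subseteq> edges G" "ends G (edges P) \<subseteq> verts P"
      "P = sub_rgraph G (verts P) (edges P)"
    and sQ: "verts Q \<subseteq> verts G" "edges Q \<subseteq> edges G" "ends G (edges Q) \<subseteq> verts Q"
      "Q = sub_rgraph G (verts Q) (edges Q)"
    using P Q by (auto simp: proper_part_def ribbon_subgraph_def)
  have W: "verts P \<union> verts Q \<subseteq> verts G" "edges P \<union> edges Q \<subseteq> edges G"
    "ends G (edges P \<union> edges Q) \<subseteq> verts P \<union> verts Q"
    using sP sQ by (auto simp: ends_Un)
  have fin: "finite (verts P \<inter> verts Q)" using assms(4) by (intro card_ge_0_finite) simp
  have ne: "verts P \<inter> verts Q \<noteq> {}" using assms(4) by auto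
  have cP: "connected_rgraph (sub_rgraph G (verts P) (edges P))"
    and cQ: "connected_rgraph (sub_rgraph G (verts Q) (edges Q))"
    using P Q unfolding proper_part_def by (subst sP(4)[symmetric] sQ(4)[symmetric], blast)+
  have conn: "connected_rgraph K" unfolding K_def using connected_union[OF cP cQ ne] .
  show "proper_part G K"
    using conn W P unfolding proper_part_def ribbon_subgraph_def by (simp add: K_def)
  have "ribbon_subgraph P K" "ribbon_subgraph Q K"
    unfolding K_def using P Q W by (auto simp: proper_part_def intro!: ribbon_subgraph_sub)
  then show "n_sum 1 K P Q"
    using conn P Q assms(3,4) fin unfolding n_sum_def proper_part_def by (simp add: K_def)
  show "n_sum 1 G P Q" if "verts P \<union> verts Q = verts G" "edges P \<union> edges Q = edges G" "connected_rgraph G"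
    using that P Q assms(3,4) fin unfolding n_sum_def proper_part_def by simp
qed

lemma one_sum_seq_parts:
  assumes "Hs \<noteq> []" "\<forall>H\<in>set Hs. proper_part G H" "distinct Hs"
    and "\<forall>H\<in>set Hs. \<forall>K\<in>set Hs. H \<noteq> K \<longrightarrow> edges H \<inter> edges K = {}"
    and "\<forall>i. 0 < i \<and> i < length Hs \<longrightarrow> card (\<Union> (verts ` set (take i Hs)) \<inter> verts (Hs ! i)) = 1"
  shows "one_sum_seq Hs (sub_rgraph G (\<Union> (verts ` set Hs)) (\<Union> (edges ` set Hs))) \<and>
    proper_part G (sub_rgraph G (\<Union> (verts ` set Hs)) (\<Union> (edges ` set Hs)))"
  using assms
proof (induction Hs rule: rev_induct)
  case (snoc H Hs)
  show ?case
  proof (cases "Hs = []")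
    case True
    have "proper_part G H" using snoc.prems(2) by simp
    moreover from this have "H = sub_rgraph G (verts H) (edges H)"
      by (simp add: proper_part_def ribbon_subgraph_def)
    ultimately show ?thesis using True one_sum_seq.single[of H] by simp
  next
    case False
    let ?K = "sub_rgraph G (\<Union> (verts ` set Hs)) (\<Union> (edges ` set Hs))"
    have c: "card (\<Union> (verts ` set (take i Hs)) \<inter> verts (Hs ! i)) = 1" if "0 < i" "i < length Hs" for i
      using snoc.prems(5)[rule_format, of i] that by (simp add: nth_append)
    have IH: "one_sum_seq Hs ?K" "proper_part G ?K"
      using snoc.IH[OF False] snoc.prems(2-4) c by simp_all
    have H: "proper_part G H" using snoc.prems(2) by simp
    have e: "edges ?K \<inter> edges H = {}" using snoc.prems(3,4) by auto
    have v: "card (verts ?K \<inter> verts H) = 1"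
      using snoc.prems(5)[rule_format, of "length Hs"] False by simp
    have eq: "sub_rgraph G (\<Union> (verts ` set (Hs @ [H]))) (\<Union> (edges ` set (Hs @ [H]))) =
      sub_rgraph G (verts ?K \<union> verts H) (edges ?K \<union> edges H)"
      by (simp add: Un_commute)
    show ?thesis unfolding eq
      using one_sum_parts(1,2)[OF IH(2) H e v] one_sum_seq.step[OF IH(1)] by blast
  qed
qed simp

text \<open>The final 1-sum must yield \<open>G\<close> itself as a record, so it is split off from
  the others; hence the demand for two summands.\<close>

lemma one_sum_seq_spanning:
  assumes "2 \<le> length Hs" "\<forall>H\<in>set Hs. proper_part G H" "distinct Hs"
    and "\<forall>H\<in>set Hs. \<forall>K\<in>set Hs. H \<noteq> K \<longrightarrow> edges H \<inter> edges K = {}"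
    and "\<forall>i. 0 < i \<and> i < length Hs \<longrightarrow> card (\<Union> (verts ` set (take i Hs)) \<inter> verts (Hs ! i)) = 1"
    and "connected_rgraph G" "\<Union> (verts ` set Hs) = verts G" "\<Union> (edges ` set Hs) = edges G"
  shows "one_sum_seq Hs G"
proof -
  obtain Hs' H where Hs: "Hs = Hs' @ [H]" using assms(1) by (cases Hs rule: rev_cases) auto
  have ne: "Hs' \<noteq> []" using assms(1) Hs by auto
  let ?K = "sub_rgraph G (\<Union> (verts ` set Hs')) (\<Union> (edges ` set Hs'))"
  have c: "card (\<Union> (verts ` set (take i Hs')) \<inter> verts (Hs' ! i)) = 1" if "0 < i" "i < length Hs'" for i
    using assms(5)[rule_format, of i] that by (simp add: nth_append Hs)
  have K: "one_sum_seq Hs' ?K" "proper_part G ?K"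
    using one_sum_seq_parts[OF ne] assms(2-4) c Hs by simp_all
  have H: "proper_part G H" using assms(2) Hs by simp
  have e: "edges ?K \<inter> edges H = {}" using assms(3,4) Hs by auto
  have v: "card (verts ?K \<inter> verts H) = 1"
    using assms(5)[rule_format, of "length Hs'"] ne Hs by simp
  have "n_sum 1 G ?K H"
    by (rule one_sum_parts(3)[OF K(2) H e v]) (use assms(6-8) Hs in auto)
  then show ?thesis unfolding Hs by (rule one_sum_seq.step[OF K(1)])
qed

section \<open>Components as summands\<close>

lemma connected_component:
  assumes C: "C \<in> vclass G ` verts G"
  shows "connected_rgraph (sub_rgraph G C (edges_at G C))"
proof -
  let ?H = "sub_rgraph G C (edges_at G C)"
  have reach: "v \<in> C \<and> (u, v) \<in> (adj ?H)\<^sup>*" if "u \<in> C" "(u, v) \<in> (adj G)\<^sup>*" for u v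
    using that(2)
  proof induction
    case (step v w)
    then obtain x where x: "x \<in> flags G" "v = vert_of G x" "w = vert_of G (side G x)"
      by (auto simp: adj_def)
    have "x \<in> flags_on G (edges_at G C)" using flags_on_edges_at[OF C] x step(3) by blast
    then have "(v, w) \<in> adj ?H" using x(2,3) by (auto simp: adj_sub)
    moreover have "w \<in> C" using vclass_side[OF C x(1)] x(2,3) step(3) by blast
    ultimately show ?case using step(3) by auto
  qed (use that(1) in simp)
  have "(u, v) \<in> (adj G)\<^sup>*" if "u \<in> C" "v \<in> C" for u v
    using C that adj_reach_sym by (auto simp: vclass_def intro: rtrancl_trans)
  moreover have "C \<noteq> {}" using C vclass_refl by blast
  ultimately show ?thesis unfolding connected_rgraph_def sub_rgraph_sel using reach by blast
qed

lemma sum_card_components: "(\<Sum>H\<in>components G. card (verts H)) = card (verts G)"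
proof -
  have "(\<Sum>H\<in>components G. card (verts H)) = (\<Sum>C\<in>vclass G ` verts G. card C)"
    unfolding components_eq by (subst sum.reindex[OF inj_sub_rgraph]) simp
  also have "\<dots> = card (\<Union>C\<in>vclass G ` verts G. C)"
  proof (rule card_UN_disjoint[symmetric])
    show "finite (vclass G ` verts G)" using finite_verts by simp
    show "\<forall>C\<in>vclass G ` verts G. finite C" using finite_verts by (auto simp: vclass_def)
    show "\<forall>C\<in>vclass G ` verts G. \<forall>D\<in>vclass G ` verts G. C \<noteq> D \<longrightarrow> C \<inter> D = {}"
      using vclass_disjoint by blast
  qed
  finally show ?thesis using Union_vclass by simp
qed

lemma component_meet:
  assumes "H \<in> components G" "H' \<in> components G" "verts H \<inter> verts H' \<noteq> {}"
  shows "H = H'"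
proof -
  obtain C D where C: "C \<in> vclass G ` verts G" "H = sub_rgraph G C (edges_at G C)"
    and D: "D \<in> vclass G ` verts G" "H' = sub_rgraph G D (edges_at G D)"
    using assms(1,2) unfolding components_eq by blast
  then obtain v where "v \<in> C" "v \<in> D" using assms(3) by auto
  then have "C = D" by (rule vclass_disjoint[OF C(1) D(1)])
  then show ?thesis using C(2) D(2) by simp
qed

lemma component_edges_disjoint:
  assumes "H \<in> components G" "H' \<in> components G" "H \<noteq> H'"
  shows "edges H \<inter> edges H' = {}"
proof (rule ccontr)
  assume "edges H \<inter> edges H' \<noteq> {}"
  then obtain e where e: "e \<in> edges H" "e \<in> edges H'" by blast
  obtain C D where C: "C \<in> vclass G ` verts G" "H = sub_rgraph G C (edges_at G C)"
    and D: "D \<in> vclass G ` verts G" "H' = sub_rgraph G D (edges_at G D)"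
    using assms(1,2) unfolding components_eq by blast
  obtain x where x: "x \<in> flags G" "vert_of G x \<in> C" "e = edge_of G x"
    using e(1) C(2) by (auto simp: edges_at_def)
  then have "vert_of G x \<in> D" using edges_at_vclass[OF D(1)] e(2) D(2) by simp
  then show False using vclass_disjoint[OF C(1) D(1)] x assms(3) C(2) D(2) by blast
qed

lemma component_at:
  assumes "x \<in> flags G"
  obtains H where "H \<in> components G" "vert_of G x \<in> verts H" "vert_of G (side G x) \<in> verts H"
    "edge_of G x \<in> edges H"
proof -
  obtain C where C: "C \<in> vclass G ` verts G" "vert_of G x \<in> C"
    using Union_vclass vert_of_in[OF assms] by blast
  show ?thesis
    by (rule that[of "sub_rgraph G C (edges_at G C)"])
      (use C vclass_side[OF C(1) assms] edges_at_vclass[OF C(1) assms] in \<open>auto simp: components_eq\<close>)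
qed

text \<open>Nested restriction turns a component of \<open>restrict_edges G B\<close> into a ribbon
  subgraph of \<open>G\<close>. It has an edge because every vertex of
  \<open>restrict_edges G B\<close> is an end of one.\<close>

lemma component_restrict:
  assumes B: "B \<subseteq> edges G" and H: "H \<in> components (restrict_edges G B)"
  shows "proper_part G H" "edges H \<subseteq> B" "verts H \<subseteq> ends G B"
proof -
  let ?K = "restrict_edges G B"
  have K: "?K = sub_rgraph G (ends G B) B" by (simp add: restrict_edges_def)
  interpret K: ribbon_graph ?K unfolding K by (rule ribbon_graph_sub) (use B ends_subset in auto)
  obtain C where C: "C \<in> vclass ?K ` verts ?K" "H = sub_rgraph ?K C (edges_at ?K C)"
    using H unfolding components_eq by blast
  have e: "edges_at ?K C \<subseteq> B" using K.edges_at_subset[of C] by (simp add: K)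
  have HG: "H = sub_rgraph G C (edges_at ?K C)"
    unfolding C(2) by (subst (1) K, rule sub_sub_rgraph) (use B ends_subset e in auto)
  show "edges H \<subseteq> B" using e HG by simp
  have CV: "C \<subseteq> ends G B" using C(1) by (auto simp: vclass_def K)
  then show "verts H \<subseteq> ends G B" using HG by simp
  have "ends G (edges_at ?K C) \<subseteq> C"
    using K.ends_edges_at[OF C(1)] ends_sub[OF e, of "ends G B"] by (simp add: K)
  moreover have "connected_rgraph H" using K.connected_component[OF C(1)] C(2) by simp
  moreover have "edges H \<noteq> {}"
  proof -
    obtain u where u: "u \<in> C" using C(1) K.vclass_refl by blast
    then obtain x where x: "x \<in> flags_on G B" "u = vert_of G x" using CV by (auto simp: ends_def)
    then have "x \<in> flags ?K" "vert_of ?K x \<in> C" using u by (simp_all add: K)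
    then show ?thesis using HG by (auto simp: edges_at_def)
  qed
  ultimately show "proper_part G H"
    unfolding proper_part_def ribbon_subgraph_def using HG CV e B ends_subset[of B] by auto
qed

end

subsection \<open>The vertex count of a biseparation\<close>

context ribbon_graph
begin

lemma ribbon_graph_restrict: "B \<subseteq> edges G \<Longrightarrow> ribbon_graph (restrict_edges G B)"
  unfolding restrict_edges_def by (rule ribbon_graph_sub) (use ends_subset in auto)

lemma sum_card_components_restrict:
  assumes "B \<subseteq> edges G"
  shows "(\<Sum>H\<in>components (restrict_edges G B). card (verts H)) = card (ends G B)"
  using ribbon_graph.sum_card_components[OF ribbon_graph_restrict[OF assms]]
  by (simp add: restrict_edges_def)

lemma finite_components: "finite (components G)"
  using finite_verts by (simp add: components_def)

lemma component_restrict_at: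
  assumes "B \<subseteq> edges G" "x \<in> flags_on G B"
  obtains H where "H \<in> components (restrict_edges G B)" "vert_of G x \<in> verts H"
    "vert_of G (side G x) \<in> verts H" "edge_of G x \<in> edges H"
proof -
  have "x \<in> flags (restrict_edges G B)" using assms(2) by (simp add: restrict_edges_def)
  then obtain H where "H \<in> components (restrict_edges G B)"
    "vert_of (restrict_edges G B) x \<in> verts H"
    "vert_of (restrict_edges G B) (side (restrict_edges G B) x) \<in> verts H"
    "edge_of (restrict_edges G B) x \<in> edges H"
    by (rule ribbon_graph.component_at[OF ribbon_graph_restrict[OF assms(1)]])
  then show ?thesis using that assms(2) by (simp add: restrict_edges_def side_in)
qed

text \<open>The edge sets lie in \<open>A\<close> and in its complement respectively and are
  non-empty, so no record belongs to both families.\<close>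

lemma components_restrict_disjoint:
  assumes "A \<subseteq> edges G"
  shows "components (restrict_edges G A) \<inter> components (restrict_edges G (edges G - A)) = {}"
proof (rule ccontr)
  assume "\<not> ?thesis"
  then obtain H where "H \<in> components (restrict_edges G A)"
    "H \<in> components (restrict_edges G (edges G - A))" by blast
  then have "edges H \<subseteq> A" "edges H \<subseteq> edges G - A" "edges H \<noteq> {}"
    using component_restrict[of A] component_restrict[of "edges G - A"] assms
    unfolding proper_part_def by blast+
  then show False by blast
qed

text \<open>This is k(B); vertices meeting no edge of \<open>B\<close> count as components of their
  own.\<close>

definition spanning_comps :: "'e set \<Rightarrow> nat" where
  "spanning_comps B = card (components (sub_rgraph G (verts G) B))"

lemma spanning_comps_eq:
  assumes "B \<subseteq> edges G"
  shows "spanning_comps B + card (ends G B) = card (components (restrict_edges G B)) + card (verts G)"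
proof -
  have "finite (ends G B)" using ends_subset finite_verts finite_subset by blast
  then have "card (verts G - ends G B) + card (ends G B) = card (verts G)"
    using ends_subset[of B] finite_verts by (simp add: card_Diff_subset card_mono)
  then show ?thesis
    using card_components_sub[OF order_refl assms ends_subset]
    by (simp add: spanning_comps_def restrict_edges_def)
qed

text \<open>On each side the vertex sets of the components partition the ends of that side's edges,
  so the vertex count of a 1-sum sequence becomes a relation between the two sides.\<close>

lemma one_sum_seq_count:
  assumes A: "A \<subseteq> edges G"
    and Hs: "one_sum_seq Hs G" "distinct Hs"
      "set Hs = components (restrict_edges G A) \<union> components (restrict_edges G (edges G - A))"
  shows "card (verts G) + card (components (restrict_edges G A)) +
      card (components (restrict_edges G (edges G - A))) =
    card (ends G A) + card (ends G (edges G - A)) + 1"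
proof -
  let ?P = "components (restrict_edges G A)" and ?Q = "components (restrict_edges G (edges G - A))"
  have fin: "finite ?P" "finite ?Q" using Hs(3) by (metis List.finite_set finite_Un)+
  note disj = components_restrict_disjoint[OF A]
  have "length Hs = card ?P + card ?Q"
    using distinct_card[OF Hs(2)] Hs(3) card_Un_disjoint[OF fin disj] by simp
  moreover have "(\<Sum>H\<leftarrow>Hs. card (verts H)) = card (ends G A) + card (ends G (edges G - A))"
    unfolding sum_list_distinct_conv_sum_set[OF Hs(2)] Hs(3) sum.union_disjoint[OF fin disj]
    by (simp add: sum_card_components_restrict A)
  ultimately show ?thesis using one_sum_seq_card[OF Hs(1) finite_verts] by simp
qed

text \<open>Each summand of a greedy ordering meets the union of the earlier ones in at least one vertex,
  and the count of vertices leaves no room for a second one.\<close>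

lemma count_biseparation:
  assumes conn: "connected_rgraph G" and A: "A \<subseteq> edges G" "A \<noteq> {}" "A \<noteq> edges G"
    and count: "card (verts G) + card (components (restrict_edges G A)) +
      card (components (restrict_edges G (edges G - A))) =
      card (ends G A) + card (ends G (edges G - A)) + 1"
  shows "biseparation G A"
proof -
  let ?P = "components (restrict_edges G A)" and ?Q = "components (restrict_edges G (edges G - A))"
  let ?S = "?P \<union> ?Q"
  have A': "edges G - A \<subseteq> edges G" by blast
  note RA = ribbon_graph_restrict[OF A(1)] and RA' = ribbon_graph_restrict[OF A']
  have fin: "finite ?P" "finite ?Q"
    using ribbon_graph.finite_components RA RA' by blast+
  note disj = components_restrict_disjoint[OF A(1)]
  have part: "proper_part G H" if "H \<in> ?S" for H
    using that component_restrict(1) A(1) A' by blast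
  have sub: "verts H \<subseteq> verts G" "edges H \<subseteq> edges G" if "H \<in> ?S" for H
    using part[OF that] by (auto simp: proper_part_def ribbon_subgraph_def)
  have edges_disj: "edges H \<inter> edges K = {}" if "H \<in> ?S" "K \<in> ?S" "H \<noteq> K" for H K
  proof -
    have PQ: "edges H \<inter> edges K = {}" if "H \<in> ?P" "K \<in> ?Q" for H K
      using component_restrict(2)[OF A(1) that(1)] component_restrict(2)[OF A' that(2)] by blast
    show ?thesis
      using that PQ[of H K] PQ[of K H] ribbon_graph.component_edges_disjoint[OF RA, of H K]
        ribbon_graph.component_edges_disjoint[OF RA', of H K] by blast
  qed
  have at: "\<exists>H\<in>?S. vert_of G x \<in> verts H \<and> vert_of G (side G x) \<in> verts H \<and> edge_of G x \<in> edges H"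
    if x: "x \<in> flags G" for x
  proof (cases "edge_of G x \<in> A")
    case True
    then show ?thesis using component_restrict_at[OF A(1), of x] x by blast
  next
    case False
    then have "x \<in> flags_on G (edges G - A)" using x edge_in by simp
    then show ?thesis using component_restrict_at[OF A', of x] by blast
  qed
  have flags_ne: "flags G \<noteq> {}" using A(1,2) edge_of_image by blast
  then have Sne: "?S \<noteq> {}" using at by blast
  \<comment> \<open>If no further summand met \<open>T\<close>, its vertex union would be closed
    under adjacency, because some summand contains both ends of each edge; connectivity would then
    spread it over all vertices.\<close>
  have next_summand: "\<exists>H\<in>?S - T. \<exists>K\<in>T. verts H \<inter> verts K \<noteq> {}" if T: "T \<subset> ?S" "T \<noteq> {}" for T
  proof (rule ccontr)
    assume none: "\<not> ?thesis"
    let ?U = "\<Union> (verts ` T)"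
    have closed: "v \<in> ?U" if uv: "(u, v) \<in> adj G" "u \<in> ?U" for u v
    proof -
      obtain x where x: "x \<in> flags G" "u = vert_of G x" "v = vert_of G (side G x)"
        using uv(1) by (auto simp: adj_def)
      obtain H where H: "H \<in> ?S" "u \<in> verts H" "v \<in> verts H" using at[OF x(1)] x(2,3) by blast
      then have "H \<in> T" using none uv(2) by blast
      then show ?thesis using H by blast
    qed
    have reach: "v \<in> ?U" if "(u, v) \<in> (adj G)\<^sup>*" "u \<in> ?U" for u v
      using that by (induction rule: rtrancl_induct) (use closed in blast)+
    have ne: "verts H \<noteq> {}" if "H \<in> ?S" for H
      using part[OF that] by (auto simp: proper_part_def connected_rgraph_def)
    obtain K where "K \<in> T" using T(2) by blast
    then obtain u where u: "u \<in> ?U" "u \<in> verts G" using ne[of K] sub(1)[of K] T(1) by blast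
    obtain H where H: "H \<in> ?S - T" using T(1) by blast
    then obtain v where v: "v \<in> verts H" "v \<in> verts G" using ne[of H] sub(1)[of H] by blast
    have "(u, v) \<in> (adj G)\<^sup>*" using conn u(2) v(2) by (simp add: connected_rgraph_def)
    then have "v \<in> ?U" using reach u(1) by blast
    then show False using none H v(1) by blast
  qed
  obtain Hs where Hs: "distinct Hs" "set Hs = ?S"
    and meets: "\<And>i. 0 < i \<Longrightarrow> i < length Hs \<Longrightarrow> \<exists>j<i. verts (Hs ! i) \<inter> verts (Hs ! j) \<noteq> {}"
    using greedy_order[OF _ Sne next_summand] fin by blast
  have V: "\<Union> (verts ` set Hs) = verts G"
  proof
    show "\<Union> (verts ` set Hs) \<subseteq> verts G" using sub(1) Hs(2) by blast
    show "verts G \<subseteq> \<Union> (verts ` set Hs)"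
    proof
      fix v assume "v \<in> verts G"
      then obtain x where "x \<in> flags G" "v = vert_of G x"
        using connected_no_isolated[OF conn flags_ne] by blast
      then show "v \<in> \<Union> (verts ` set Hs)" using at[of x] Hs(2) by blast
    qed
  qed
  have E: "\<Union> (edges ` set Hs) = edges G"
  proof
    show "\<Union> (edges ` set Hs) \<subseteq> edges G" using sub(2) Hs(2) by blast
    show "edges G \<subseteq> \<Union> (edges ` set Hs)"
    proof
      fix e assume "e \<in> edges G"
      then obtain x where "x \<in> flags G" "e = edge_of G x" using edge_of_image by blast
      then show "e \<in> \<Union> (edges ` set Hs)" using at[of x] Hs(2) by blast
    qed
  qed
  have len: "length Hs = card ?P + card ?Q"
    using distinct_card[OF Hs(1)] Hs(2) card_Un_disjoint[OF fin disj] by simp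
  have sum: "(\<Sum>H\<leftarrow>Hs. card (verts H)) = card (ends G A) + card (ends G (edges G - A))"
    unfolding sum_list_distinct_conv_sum_set[OF Hs(1)] Hs(2) sum.union_disjoint[OF fin disj]
    by (simp add: sum_card_components_restrict A)
  have "Hs \<noteq> []" using Sne Hs(2) by auto
  moreover have "\<forall>H\<in>set Hs. finite (verts H)" using sub(1) Hs(2) finite_verts finite_subset by metis
  \<comment> \<open>The assumed count is the equality case of
    \<open>overlapping_union_card\<close>.\<close>
  ultimately have single: "\<forall>i. 0 < i \<and> i < length Hs \<longrightarrow>
      card (\<Union> (verts ` set (take i Hs)) \<inter> verts (Hs ! i)) = 1"
    using overlapping_union_card[of Hs verts] meets V len sum count by simp
  have "2 \<le> length Hs"
  proof -
    obtain e e' where e: "e \<in> A" "e' \<in> edges G - A" using A by blast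
    have "e \<in> edge_of G ` flags G" "e' \<in> edge_of G ` flags G"
      using e A(1) unfolding edge_of_image by blast+
    then obtain x y where x: "x \<in> flags_on G A" and y: "y \<in> flags_on G (edges G - A)"
      using e by auto
    have "?P \<noteq> {}" by (rule component_restrict_at[OF A(1) x]) blast
    moreover have "?Q \<noteq> {}" by (rule component_restrict_at[OF A' y]) blast
    ultimately have "1 \<le> card ?P" "1 \<le> card ?Q" using fin by (simp_all add: Suc_le_eq card_gt_0_iff)
    then show ?thesis using len by simp
  qed
  then have "one_sum_seq Hs G"
    by (rule one_sum_seq_spanning) (use part edges_disj Hs single conn V E in \<open>simp_all only:\<close>, blast+)
  moreover have "\<exists>j<i. verts (Hs ! i) \<inter> verts (Hs ! j) \<noteq> {} \<and>
      (Hs ! i \<in> ?P \<and> Hs ! j \<in> ?Q \<or> Hs ! i \<in> ?Q \<and> Hs ! j \<in> ?P)" if i: "0 < i" "i < length Hs" for i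
  proof -
    obtain j where j: "j < i" "verts (Hs ! i) \<inter> verts (Hs ! j) \<noteq> {}" using meets i by blast
    have "Hs ! i \<noteq> Hs ! j" using Hs(1) i j(1) by (simp add: nth_eq_iff_index_eq)
    moreover have "Hs ! i \<in> ?S" "Hs ! j \<in> ?S" using Hs(2) i j(1) nth_mem[of i Hs] nth_mem[of j Hs] by auto
    \<comment> \<open>Different components on one side share no vertex, so two summands that meet
      come from opposite sides.\<close>
    ultimately show ?thesis
      using j ribbon_graph.component_meet[OF RA _ _ j(2)] ribbon_graph.component_meet[OF RA' _ _ j(2)]
      by blast
  qed
  ultimately show ?thesis unfolding biseparation_def Let_def using Hs by blast
qed

lemma flags_on_edges: "flags_on G (edges G) = flags G"
  using edge_in by blast

lemma spanning_comps_empty: "spanning_comps {} = card (verts G)"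
  using spanning_comps_eq[of "{}"] by (simp add: ends_def restrict_edges_def card_components)

text \<open>Adjacency agrees with that of \<open>G\<close>, although the restriction to all vertices
  and edges need not be the record \<open>G\<close>.\<close>

lemma spanning_comps_edges:
  assumes "connected_rgraph G" shows "spanning_comps (edges G) = 1"
proof -
  let ?H = "sub_rgraph G (verts G) (edges G)"
  interpret H: ribbon_graph ?H by (rule ribbon_graph_sub) (use ends_subset in auto)
  have "adj ?H = adj G" unfolding adj_sub flags_on_edges adj_def[of G] ..
  then have "connected_rgraph ?H" using assms by (simp add: connected_rgraph_def)
  then show ?thesis using H.connected_components by (simp add: spanning_comps_def)
qed

lemma biseparation_iff_spanning_comps:
  assumes "connected_rgraph G" "A \<subseteq> edges G"
  shows "biseparation G A \<longleftrightarrow>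
    spanning_comps A + spanning_comps (edges G - A) = card (verts G) + 1"
proof (cases "A = {} \<or> A = edges G")
  case True
  then have "biseparation G A" by (auto simp: biseparation_def)
  \<comment> \<open>For the trivial choices of \<open>A\<close> the count holds as well: k is the
    number of vertices for no edges, and 1 for all edges.\<close>
  then show ?thesis
    using True spanning_comps_empty spanning_comps_edges[OF assms(1)] by auto
next
  case False
  have "spanning_comps A + spanning_comps (edges G - A) = card (verts G) + 1 \<longleftrightarrow>
    card (verts G) + card (components (restrict_edges G A)) +
      card (components (restrict_edges G (edges G - A))) =
    card (ends G A) + card (ends G (edges G - A)) + 1"
    using spanning_comps_eq[OF assms(2)] spanning_comps_eq[of "edges G - A"] by auto
  moreover have "biseparation G A \<longleftrightarrow> \<dots>"
  proof
    assume "biseparation G A"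
    then obtain Hs where "one_sum_seq Hs G" "distinct Hs"
      "set Hs = components (restrict_edges G A) \<union> components (restrict_edges G (edges G - A))"
      using False unfolding biseparation_def Let_def by blast
    then show "card (verts G) + card (components (restrict_edges G A)) +
        card (components (restrict_edges G (edges G - A))) =
      card (ends G A) + card (ends G (edges G - A)) + 1"
      by (rule one_sum_seq_count[OF assms(2)])
  qed (use count_biseparation[OF assms] False in blast)
  ultimately show ?thesis by simp
qed

section \<open>From the component count to Euler genus and orientability\<close>

lemma biseparation_iff_euler_genus:
  assumes "connected_rgraph G" "A \<subseteq> edges G"
  shows "biseparation G A \<longleftrightarrow> euler_genus (partial_dual G A) =
    euler_genus (restrict_edges G A) + euler_genus (delete_edges G A)"
proof -
  interpret D: ribbon_graph "partial_dual G A" by (rule ribbon_graph_partial_dual)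
  \<comment> \<open>Sides of the dual are segments of \<open>G\<close> on \<open>A\<close> and sides
    of \<open>G\<close> elsewhere, which is the rule for boundary curves of the complement of
    \<open>A\<close>.\<close>
  have "across (partial_dual G A) (edges G) x = across G (edges G - A) x" if "x \<in> flags G" for x
    using edge_in[OF that] by (simp add: across_def)
  then have orb: "orbit_of {across (partial_dual G A) (edges G), arc G} x =
      orbit_of {across G (edges G - A), arc G} x" if "x \<in> flags G" for x
    using that by (intro orbit_of_cong[of x "flags G"]) (auto simp: across_def side_in seg_in arc_in)
  \<comment> \<open>Every \<open>Inl\<close> vertex of the dual carries the flags of its orbit, so
    isolated vertices come only from those of \<open>G\<close>.\<close>
  have "isolated_verts (partial_dual G A) = Inr ` isolated_verts G"
    by (auto simp: isolated_verts_def[of "partial_dual G A"] boundary_comps_def)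
  then have bd: "card (boundary_comps (partial_dual G A) (edges G)) =
      card (boundary_comps G (edges G - A))"
    unfolding D.card_boundary_comps card_boundary_comps using orb
    by (simp add: card_image cong: image_cong)
  have D: "euler_genus (partial_dual G A) = 2 - of_nat (card (boundary_comps G A))
      + of_nat (card (edges G)) - of_nat (card (boundary_comps G (edges G - A)))"
    using D.euler_genus_eq D.connected_components[OF connected_partial_dual[OF assms(1)]] bd by simp
  have RA: "euler_genus (restrict_edges G A) = 2 * of_nat (spanning_comps A)
      - of_nat (card (verts G)) + of_nat (card A) - of_nat (card (boundary_comps G A))"
    unfolding restrict_edges_def spanning_comps_def
    by (rule euler_genus_sub) (use assms(2) ends_subset in auto)
  have DA: "euler_genus (delete_edges G A) = 2 * of_nat (spanning_comps (edges G - A))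
      - of_nat (card (verts G)) + of_nat (card (edges G - A))
      - of_nat (card (boundary_comps G (edges G - A)))"
    unfolding delete_edges_def spanning_comps_def
    by (rule euler_genus_sub) (use ends_subset in auto)
  have "card (edges G) = card A + card (edges G - A)"
    using finite_edges assms(2) by (metis card_Diff_subset card_mono finite_subset le_add_diff_inverse)
  then have "euler_genus (partial_dual G A) = euler_genus (restrict_edges G A) + euler_genus (delete_edges G A)
    \<longleftrightarrow> (of_nat (spanning_comps A + spanning_comps (edges G - A)) :: rat) = of_nat (card (verts G) + 1)"
    unfolding D RA DA by auto
  also have "\<dots> \<longleftrightarrow> biseparation G A"
    unfolding of_nat_eq_iff biseparation_iff_spanning_comps[OF assms] ..
  finally show ?thesis by blast
qed

lemma biseparation_orientable:
  assumes A: "A \<subseteq> edges G" and bisep: "biseparation G A"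
    and orient: "orientable (restrict_edges G A)" "orientable (delete_edges G A)"
  shows "orientable G"
proof -
  \<comment> \<open>Restriction to all edges changes no map on the flags but possibly the record, so
    orientability is transferred explicitly.\<close>
  have all: "orientable G" if "orientable (sub_rgraph G W (edges G))" for W
  proof -
    have "arc (sub_rgraph G W (edges G)) x = arc G x" if "x \<in> flags G" for x
      by (rule arc_sub_rgraph[OF _ arc_walk.start]) (use that edge_in arc_in in blast)+
    then show ?thesis
      using that unfolding orientable_def sub_rgraph_sel(3) flags_on_edges
      by (simp add: edge_in cong: ball_cong)
  qed
  consider "A = edges G" | "A = {}" | Hs where "one_sum_seq Hs G"
      "set Hs = components (restrict_edges G A) \<union> components (restrict_edges G (edges G - A))"
    using bisep unfolding biseparation_def Let_def by blast
  then show ?thesis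
  proof cases
    case 1 then show ?thesis using all orient(1) by (simp add: restrict_edges_def)
  next
    case 2 then show ?thesis using all orient(2) by (simp add: delete_edges_def)
  next
    case 3
    \<comment> \<open>This differs from \<open>delete_edges G A\<close> only in isolated vertices,
      which carry no flags.\<close>
    have "orientable (restrict_edges G (edges G - A))"
      using orient(2) orientable_sub_verts unfolding restrict_edges_def delete_edges_def by blast
    then have "orientable H" if "H \<in> set Hs" for H
      using that orient(1) 3(2) ribbon_graph.orientable_sub[OF ribbon_graph_restrict]
        A unfolding components_eq by auto
    then show ?thesis using one_sum_seq_orientable[OF 3(1)] ribbon_graph_axioms by blast
  qed
qed

end

theorem theorem1:
  fixes G :: "('v, 'e, 'f) rgraph" and A :: "'e set"
  assumes "ribbon_graph G" and "connected_rgraph G" and "A \<subseteq> edges G"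
  shows "(biseparation G A \<longleftrightarrow>
      euler_genus (partial_dual G A)
        = euler_genus (restrict_edges G A) + euler_genus (delete_edges G A)) \<and>
    (biseparation G A \<longrightarrow>
      (orientable (partial_dual G A) \<longleftrightarrow>
        orientable (restrict_edges G A) \<and> orientable (delete_edges G A)))"
proof -
  interpret ribbon_graph G by fact
  have "orientable (restrict_edges G A) \<and> orientable (delete_edges G A)" if "orientable G"
    using orientable_sub[OF that] by (simp add: restrict_edges_def delete_edges_def)
  \<comment> \<open>Orientability is compared through \<open>G\<close>: duality preserves it,
    restriction passes it down, and the 1-sums of a biseparation bring it back up.\<close>
  then show ?thesis
    using biseparation_iff_euler_genus biseparation_orientable orientable_partial_dual assms(2,3)
    by blast
qed

end
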